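(* Let $s \in S_d(q)$ be a \begin{itemize} \item a type 1 generator of $\Gamma_d(q)$ of the form $\left( \begin{array}{cc} t+l_i & b \\ 0 & 1 \end{array} \right)$, or \item a type 2 generator of the form $\left( \begin{array}{cc} (t+l_i)(t+l_j)^{-1} & b(t+l_j)^{-1} \\ 0 & 1 \end{array} \right)$ \end{itemize} where $1 \leq i,j \leq d-1$, $i < j$ and $b \in \mathbb{Z}_q$. The language ${\mathcal L}_s = \{ \otimes(\nu(g),\nu(gs)) | g \in \Gamma_d(q) \}$ is a regular language.
   Context: Setting: $d \geq 3$, the coefficient ring is $\mathbb{Z}_q$, and $l_1,\dots,l_{d-1} \in \mathbb{Z}_q$ are distinct elements whose pairwise differences are invertible and which are themselves invertible. Let $\mathcal{R}_d = \mathbb{Z}_q[t,(t+l_1)^{-1},\dots,(t+l_{d-1})^{-1}]$. The Diestel-Leader group $\Gamma_d(q)$ is the group of affine matrices $g=\begin{pmatrix} (t+l_1)^{m_1}\cdots(t+l_{d-1})^{m_{d-1}} & R\\ 0 & 1\end{pmatrix}$ with $m_k \in \mathbb{Z}$, $R \in \mathcal{R}_d$, with finite generating set $S_d(q)$ consisting of the matrices $\begin{pmatrix} t+l_i & b\\ 0&1\end{pmatrix}^{\pm1}$ and $\begin{pmatrix} (t+l_i)(t+l_j)^{-1} & -b(t+l_j)^{-1}\\ 0&1\end{pmatrix}$ for $b\in\mathbb{Z}_q$, $i\neq j$. $\nu(g)$ denotes the normal form of $g$: with $R' = \prod_{k=1}^{d-1}(t+l_k)^{-m_k}R$ decomposed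 uniquely as $R_1+\cdots+R_d$ (for $i<d$, $R_i$ a polynomial in $t+l_i$ with only negative-degree terms; $R_d$ a polynomial in $t^{-1}$ with only non-positive-degree terms), $\nu(g)$ is the concatenation of the prefix string $\epsilon_1^{m_1}\#\cdots\#\epsilon_{d-1}^{m_{d-1}}$ over $\{x,y,\#\}$ ($|m_i|$ copies of $\epsilon_i$, with $\epsilon_i=x$ if $m_i>0$, $y$ if $m_i<0$, omitted if $m_i=0$) and the suffix string $S_1\#\cdots\#S_d$ over $\{\#\}\cup\mathbb{Z}_q$, where $S_i$ lists the coefficients of $R_i$ from degree $-1$ (degree $0$ for $i=d$) down to its minimal degree, empty if $R_i=0$. For words $w_1,w_2$, the convolution $\otimes(w_1,w_2)$ is the word of length $\max|w_i|$ over pairs of letters whose $k$-th letter is the pair of $k$-th letters of $w_1,w_2$, padded with a new symbol $\diamond$ when a word is shorter. *)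

theory Defs
  imports "HOL-Computational_Algebra.Polynomial" "HOL-Computational_Algebra.Formal_Laurent_Series"
    "Berlekamp_Zassenhaus.Finite_Field"
begin

text \<open>Model. The coefficient ring Z_q is the type 'q mod_ring (q = CARD('q) >= 2).
  The ring R_d = Z_q[t, (t+l_1)^-1, ..., (t+l_(d-1))^-1] is realised inside the ring of formal
  Laurent series Z_q((t^-1)) (variable X = t^-1), via t |-> X^-1; in that ring every t + l is a unit.
  The indices 1..d-1 of the paper are 0..d-2 here (list positions).\<close>

definition invertible_el :: "'a::comm_ring_1 \<Rightarrow> bool" where
  "invertible_el x \<longleftrightarrow> (\<exists>y. x * y = 1)"

definition tt :: "'a::comm_ring_1 fls" where
  "tt = fls_X_inv"

definition lin :: "'a::comm_ring_1 \<Rightarrow> 'a fls" where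
  "lin a = tt + fls_const a"

definition linv :: "'a::comm_ring_1 \<Rightarrow> 'a fls" where
  "linv a = (THE y. lin a * y = 1)"

definition lpow :: "'a::comm_ring_1 \<Rightarrow> int \<Rightarrow> 'a fls" where
  "lpow a n = (if n \<ge> 0 then lin a ^ nat n else linv a ^ nat (- n))"

definition poly_fls :: "'a::comm_ring_1 poly \<Rightarrow> 'a fls" where
  "poly_fls P = (\<Sum>i\<le>Polynomial.degree P. fls_const (Polynomial.coeff P i) * tt ^ i)"

definition Ufac :: "'a::comm_ring_1 list \<Rightarrow> int list \<Rightarrow> 'a fls" where
  "Ufac l m = (\<Prod>k<length l. lpow (l ! k) (m ! k))"

definition Rd :: "'a::comm_ring_1 list \<Rightarrow> 'a fls set" where
  "Rd l = {poly_fls P * (\<Prod>k<length l. linv (l ! k) ^ (n k)) | P n. True}"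

text \<open>A group element [[Ufac l m, R],[0,1]] is represented by the pair (m, R).\<close>
definition Gamma :: "'a::comm_ring_1 list \<Rightarrow> (int list \<times> 'a fls) set" where
  "Gamma l = {(m, R). length m = length l \<and> R \<in> Rd l}"

text \<open>matrix product [[a,R],[0,1]] * [[a',R'],[0,1]] = [[a a', R + a R'],[0,1]]\<close>
definition gmult :: "'a::comm_ring_1 list \<Rightarrow> (int list \<times> 'a fls) \<Rightarrow> (int list \<times> 'a fls)
    \<Rightarrow> (int list \<times> 'a fls)" where
  "gmult l g h = (map2 (+) (fst g) (fst h), snd g + Ufac l (fst g) * snd h)"

definition gen1 :: "'a::comm_ring_1 list \<Rightarrow> nat \<Rightarrow> 'a \<Rightarrow> (int list \<times> 'a fls)" where
  "gen1 l i b = (map (\<lambda>k. if k = i then 1 else 0) [0..<length l], fls_const b)"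

definition gen2 :: "'a::comm_ring_1 list \<Rightarrow> nat \<Rightarrow> nat \<Rightarrow> 'a \<Rightarrow> (int list \<times> 'a fls)" where
  "gen2 l i j b = (map (\<lambda>k. if k = i then 1 else if k = j then -1 else 0) [0..<length l],
                   fls_const b * linv (l ! j))"

datatype 'a sym = SX | SY | SHash | SDig 'a

fun hash_join :: "'a sym list list \<Rightarrow> 'a sym list" where
  "hash_join [] = []"
| "hash_join [w] = w"
| "hash_join (w # ws) = w @ SHash # hash_join ws"

text \<open>The unique decomposition R' = R_1 + ... + R_d: cs ! k lists the coefficients of
  R_(k+1) = sum_j c_j (t + l_(k+1))^-(j+1) (from degree -1 down to the minimal degree, no trailing zeros),
  and P is the polynomial part R_d (whose coefficient list, from t^0 upwards, is coeffs P).\<close>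
definition decomp :: "'a::comm_ring_1 list \<Rightarrow> 'a fls \<Rightarrow> 'a list list \<times> 'a poly" where
  "decomp l R' = (THE (cs, P). length cs = length l \<and> (\<forall>c\<in>set cs. c = [] \<or> last c \<noteq> 0) \<and>
      R' = (\<Sum>k<length l. \<Sum>j<length (cs ! k). fls_const (cs ! k ! j) * linv (l ! k) ^ (j + 1))
           + poly_fls P)"

definition prefix_str :: "int list \<Rightarrow> 'a sym list" where
  "prefix_str m = hash_join (map (\<lambda>mk. replicate (nat \<bar>mk\<bar>) (if mk > 0 then SX else SY)) m)"

definition suffix_str :: "'a::comm_ring_1 list \<Rightarrow> 'a fls \<Rightarrow> 'a sym list" where
  "suffix_str l R' = (let (cs, P) = decomp l R' in hash_join (map (map SDig) (cs @ [coeffs P])))"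

definition nf :: "'a::comm_ring_1 list \<Rightarrow> (int list \<times> 'a fls) \<Rightarrow> 'a sym list" where
  "nf l g = prefix_str (fst g) @ suffix_str l (Ufac l (map uminus (fst g)) * snd g)"

text \<open>convolution; None plays the role of the padding symbol diamond\<close>
definition conv :: "'b list \<Rightarrow> 'b list \<Rightarrow> ('b option \<times> 'b option) list" where
  "conv w1 w2 = map (\<lambda>k. (if k < length w1 then Some (w1 ! k) else None,
                          if k < length w2 then Some (w2 ! k) else None))
                    [0..<max (length w1) (length w2)]"

definition Ls :: "'a::comm_ring_1 list \<Rightarrow> (int list \<times> 'a fls) \<Rightarrow> ('a sym option \<times> 'a sym option) list set" where
  "Ls l s = {conv (nf l g) (nf l (gmult l g s)) | g. g \<in> Gamma l}"

definition regular_lang :: "'b set \<Rightarrow> 'b list set \<Rightarrow> bool" where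
  "regular_lang Sig L \<longleftrightarrow> finite Sig \<and> L \<subseteq> lists Sig \<and>
     (\<exists>(Q :: nat set) q0 (delta :: nat \<Rightarrow> 'b \<Rightarrow> nat) F.
        finite Q \<and> q0 \<in> Q \<and> F \<subseteq> Q \<and> (\<forall>q\<in>Q. \<forall>a\<in>Sig. delta q a \<in> Q) \<and>
        (\<forall>w\<in>lists Sig. w \<in> L \<longleftrightarrow> fold (\<lambda>a q. delta q a) w q0 \<in> F))"

end

theory Submission
  imports Defs
begin

text \<open>
  In partial fractions, passing from g to g s for a generator of type 1 divides by t + l_i: the digits
  at the pole -l_i are shifted by one place, the polynomial part undergoes synthetic division, and at
  every other pole the new digits satisfy a two-term recurrence. Read from left to right, each of these
  is checked with finite memory once the finitely many residues linking the blocks have been guessed,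
  so the relation between the two normal forms is a finite union of concatenations of block relations
  of bounded lag. A type 2 generator is the inverse of a type 1 generator followed by a type 1 generator,
  and synchronously regular relations are closed under converse and composition.
\<close>

section \<open>Synchronously regular relations\<close>

text \<open>The obstacle is the reading direction. At a pole \<open>-l_k\<close> other than
  \<open>-l_i\<close> the new digits obey \<open>B_j = \<delta>^-1 (A_j - B_{j+1})\<close>, hence
  are determined from the last digit backwards, and division of the polynomial part runs from the
  top degree downwards, while the words list the digits the other way round. Moreover the digit
  inserted at \<open>-l_i\<close> depends on residues of blocks that may come later. So the first
  digits and the remainder are guessed; for a wrong guess the equations between the blocks have no
  polynomial solution. The coefficient ring may have zero divisors: whatever a field would supply
  comes from the invertible differences of the \<open>l_k\<close>, or from \<open>t + c\<close>
  being monic. Automata are not built by hand. A relation is its own state, reading a letter takes a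
  derivative, and regularity is finiteness of the set of derivatives.\<close>

definition hdo :: "'a list \<Rightarrow> 'a option" where
  "hdo u = (case u of [] \<Rightarrow> None | a # _ \<Rightarrow> Some a)"

lemma hdo_simps [simp]: "hdo [] = None" "hdo (a # u) = Some a"
  by (simp_all add: hdo_def)

lemma hdo_eq_None_iff [simp]: "hdo u = None \<longleftrightarrow> u = []"
  by (cases u) auto

lemma hdo_eq_Some_iff: "hdo u = Some a \<longleftrightarrow> (\<exists>u'. u = a # u')"
  by (cases u) auto

lemma hdo_tl_inject: "hdo u = hdo v \<Longrightarrow> tl u = tl v \<Longrightarrow> u = v"
  by (cases u; cases v) auto

text \<open>
  Left derivative of a relation by one letter of a convolution. An exhausted word reads \<^const>\<open>None\<close>
  forever, which fits \<open>tl [] = []\<close>.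
\<close>

definition rderiv :: "'a option \<Rightarrow> 'b option \<Rightarrow> ('a list \<times> 'b list) set \<Rightarrow> ('a list \<times> 'b list) set" where
  "rderiv x y R = {(tl u, tl v) | u v. (u, v) \<in> R \<and> hdo u = x \<and> hdo v = y}"

lemma in_rderivI: "(u, v) \<in> R \<Longrightarrow> hdo u = x \<Longrightarrow> hdo v = y \<Longrightarrow> (tl u, tl v) \<in> rderiv x y R"
  unfolding rderiv_def by blast

lemma in_rderivE:
  assumes "p \<in> rderiv x y R"
  obtains u v where "(u, v) \<in> R" "hdo u = x" "hdo v = y" "p = (tl u, tl v)"
  using assms unfolding rderiv_def by blast

lemma rderiv_Un: "rderiv x y (R \<union> S) = rderiv x y R \<union> rderiv x y S"
  unfolding rderiv_def by blast

lemma rderiv_Union: "rderiv x y (\<Union>T) = \<Union>(rderiv x y ` T)"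
  unfolding rderiv_def by blast

lemma rderiv_None_None: "rderiv None None R = R \<inter> {([], [])}"
  unfolding rderiv_def by auto

lemma rderiv_Some_Some [simp]: "(u, v) \<in> rderiv (Some a) (Some b) R \<longleftrightarrow> (a # u, b # v) \<in> R"
  using in_rderivI[of "a # u" "b # v" R] by (auto simp: hdo_eq_Some_iff elim!: in_rderivE)

lemma rderiv_Some_None [simp]: "(u, v) \<in> rderiv (Some a) None R \<longleftrightarrow> v = [] \<and> (a # u, []) \<in> R"
  using in_rderivI[of "a # u" "[]" R] by (auto simp: hdo_eq_Some_iff elim!: in_rderivE)

lemma rderiv_None_Some [simp]: "(u, v) \<in> rderiv None (Some b) R \<longleftrightarrow> u = [] \<and> ([], b # v) \<in> R"
  using in_rderivI[of "[]" "b # v" R] by (auto simp: hdo_eq_Some_iff elim!: in_rderivE)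

text \<open>The letter \<open>y\<close> of the middle word is guessed. It may be
  \<open>None\<close>, and it may still be a letter after both outer words have ended. Gluing back
  works because \<open>hdo\<close> and \<open>tl\<close> determine a word.\<close>

lemma rderiv_relcomp: "rderiv x z (R O S) = (\<Union>y. rderiv x y R O rderiv y z S)"
proof (intro equalityI subsetI)
  fix p assume "p \<in> rderiv x z (R O S)"
  then obtain u v w where "(u, v) \<in> R" "(v, w) \<in> S" "hdo u = x" "hdo w = z" "p = (tl u, tl w)"
    by (elim in_rderivE) blast
  then have "p \<in> rderiv x (hdo v) R O rderiv (hdo v) z S"
    by (auto intro!: relcompI[of _ "tl v"] in_rderivI)
  then show "p \<in> (\<Union>y. rderiv x y R O rderiv y z S)"
    by blast
next
  fix p assume "p \<in> (\<Union>y. rderiv x y R O rderiv y z S)"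
  then obtain y u v w where p: "p = (u, w)" "(u, v) \<in> rderiv x y R" "(v, w) \<in> rderiv y z S"
    by blast
  from p(2) obtain u0 v0 where 1: "(u0, v0) \<in> R" "hdo u0 = x" "hdo v0 = y" "u = tl u0" "v = tl v0"
    by (auto elim: in_rderivE)
  from p(3) obtain v1 w0 where 2: "(v1, w0) \<in> S" "hdo v1 = y" "hdo w0 = z" "v = tl v1" "w = tl w0"
    by (auto elim: in_rderivE)
  from 1 2 have "v0 = v1" using hdo_tl_inject by metis
  then have "(u0, w0) \<in> R O S" using 1 2 by blast
  then show "p \<in> rderiv x z (R O S)" using in_rderivI[of u0 w0 "R O S"] 1 2 p(1) by simp
qed

text \<open>In the manner of Nerode and Brzozowski: the members of \<open>N\<close> are the states
  of a deterministic automaton reading convolutions, with \<open>R\<close> as initial state.\<close>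

definition autom :: "('a list \<times> 'b list) set \<Rightarrow> bool" where
  "autom R \<longleftrightarrow> (\<exists>N. finite N \<and> R \<in> N \<and> (\<forall>X\<in>N. \<forall>x y. rderiv x y X \<in> N))"

text \<open>\<open>{}\<close> and \<open>{([], [])}\<close> are sinks: their derivatives are again
  one of the two, and so is every derivative by \<open>(None, None)\<close>. Hence a candidate state
  set may leave them out.\<close>

lemma automI:
  assumes "finite N" "R \<in> N"
    and "\<And>X x y. X \<in> N \<Longrightarrow> x \<noteq> None \<or> y \<noteq> None \<Longrightarrow> rderiv x y X \<in> N \<union> {{}, {([], [])}}"
  shows "autom R"
proof -
  let ?N = "N \<union> {{}, {([], [])}}"
  have e: "rderiv x y {} = {}" for x y
    unfolding rderiv_def by simp
  have s: "rderiv x y {([], [])} \<in> ?N" for x y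
    by (cases x; cases y) (auto simp: rderiv_def)
  have n: "rderiv None None X \<in> ?N" for X
    unfolding rderiv_None_None by (cases "([], []) \<in> X") auto
  have "rderiv x y X \<in> ?N" if "X \<in> ?N" for X x y
  proof (cases "X \<in> N")
    case True
    then show ?thesis using assms(3)[of X x y] n by (cases x; cases y) auto
  next
    case False
    with that have "X = {} \<or> X = {([], [])}" by blast
    then show ?thesis
    proof
      assume "X = {}"
      then show ?thesis by (simp only: e) blast
    qed (simp only: s)
  qed
  then have "\<forall>X\<in>?N. \<forall>x y. rderiv x y X \<in> ?N" by simp
  moreover have "finite ?N" "R \<in> ?N" using assms(1,2) by simp_all
  ultimately show ?thesis unfolding autom_def by blast
qed

lemma automE:
  assumes "autom R"
  obtains N where "finite N" "R \<in> N" "\<And>X x y. X \<in> N \<Longrightarrow> rderiv x y X \<in> N"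
  using assms unfolding autom_def by blast

lemma autom_empty: "autom {}"
  by (rule automI[of "{{}}"]) (auto simp: rderiv_def)

lemma autom_Un:
  assumes "autom R" "autom S"
  shows "autom (R \<union> S)"
proof -
  obtain N where N: "finite N" "R \<in> N" "\<And>X x y. X \<in> N \<Longrightarrow> rderiv x y X \<in> N"
    using assms(1) by (rule automE) (rule that)
  obtain M where M: "finite M" "S \<in> M" "\<And>X x y. X \<in> M \<Longrightarrow> rderiv x y X \<in> M"
    using assms(2) by (rule automE) (rule that)
  show ?thesis
  proof (rule automI[of "(\<lambda>(X, Y). X \<union> Y) ` (N \<times> M)"])
    fix X x y assume "X \<in> (\<lambda>(X, Y). X \<union> Y) ` (N \<times> M)"
    then obtain A B where AB: "X = A \<union> B" "A \<in> N" "B \<in> M" by auto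
    then have "rderiv x y X = (\<lambda>(X, Y). X \<union> Y) (rderiv x y A, rderiv x y B)"
      by (simp add: rderiv_Un)
    moreover have "(rderiv x y A, rderiv x y B) \<in> N \<times> M"
      using N(3)[OF AB(2)] M(3)[OF AB(3)] by simp
    ultimately show "rderiv x y X \<in> (\<lambda>(X, Y). X \<union> Y) ` (N \<times> M) \<union> {{}, {([], [])}}"
      by (intro UnI1 image_eqI)
  qed (use N(1,2) M(1,2) in auto)
qed

lemma autom_UN: "finite I \<Longrightarrow> (\<And>i. i \<in> I \<Longrightarrow> autom (R i)) \<Longrightarrow> autom (\<Union>i\<in>I. R i)"
  by (induction I rule: finite_induct) (simp_all add: autom_empty autom_Un)

text \<open>Subset construction: a state collects the pairs of derivatives reached under all guesses
  of the middle word. A middle word outlasting both outer ones is still accounted for by the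
  composition \<open>X O Y\<close>.\<close>

lemma autom_relcomp:
  assumes "autom R" "autom S"
  shows "autom (R O S)"
proof -
  obtain N where N: "finite N" "R \<in> N" "\<And>X x y. X \<in> N \<Longrightarrow> rderiv x y X \<in> N"
    using assms(1) by (rule automE) (rule that)
  obtain M where M: "finite M" "S \<in> M" "\<And>X x y. X \<in> M \<Longrightarrow> rderiv x y X \<in> M"
    using assms(2) by (rule automE) (rule that)
  let ?g = "\<lambda>T. \<Union>(X, Y)\<in>T. X O Y"
  show ?thesis
  proof (rule automI[of "?g ` Pow (N \<times> M)"])
    show "R O S \<in> ?g ` Pow (N \<times> M)"
      using N(2) M(2) by (intro image_eqI[of _ _ "{(R, S)}"]) auto
    fix Z x z assume "Z \<in> ?g ` Pow (N \<times> M)"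
    then obtain T where T: "T \<subseteq> N \<times> M" "Z = ?g T" by auto
    let ?T = "\<Union>y. (\<lambda>(X, Y). (rderiv x y X, rderiv y z Y)) ` T"
    have "rderiv x z Z = (\<Union>(X, Y)\<in>T. rderiv x z (X O Y))"
      unfolding T(2) rderiv_Union by auto
    also have "\<dots> = ?g ?T"
      unfolding rderiv_relcomp by (simp add: split_def) blast
    finally have "rderiv x z Z = ?g ?T" .
    moreover have "?T \<subseteq> N \<times> M"
      using T(1) by (auto intro!: N(3) M(3))
    ultimately show "rderiv x z Z \<in> ?g ` Pow (N \<times> M) \<union> {{}, {([], [])}}"
      by (intro UnI1 image_eqI[of _ _ ?T] PowI)
  qed (simp add: N(1) M(1))
qed

lemma autom_converse:
  assumes "autom R"
  shows "autom (R\<inverse>)"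
proof -
  obtain N where N: "finite N" "R \<in> N" "\<And>X x y. X \<in> N \<Longrightarrow> rderiv x y X \<in> N"
    using assms by (rule automE) (rule that)
  have "rderiv x y (X\<inverse>) = (rderiv y x X)\<inverse>" for x y and X :: "('a list \<times> 'b list) set"
    unfolding rderiv_def by auto
  then show ?thesis
    using N(1,2) by (intro automI[of "converse ` N"]) (auto intro!: N(3))
qed

section \<open>Concatenation of relations and harmless left factors\<close>

definition conc :: "('a list \<times> 'b list) set \<Rightarrow> ('a list \<times> 'b list) set \<Rightarrow> ('a list \<times> 'b list) set"
    (infixr "\<odot>" 70) where
  "R \<odot> S = {(u @ u', v @ v') | u v u' v'. (u, v) \<in> R \<and> (u', v') \<in> S}"

lemma concI: "(u, v) \<in> R \<Longrightarrow> (u', v') \<in> S \<Longrightarrow> (u @ u', v @ v') \<in> R \<odot> S"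
  unfolding conc_def by blast

lemma concE:
  assumes "p \<in> R \<odot> S"
  obtains u v u' v' where "p = (u @ u', v @ v')" "(u, v) \<in> R" "(u', v') \<in> S"
  using assms unfolding conc_def by blast

lemma conc_assoc: "(R \<odot> S) \<odot> T = R \<odot> (S \<odot> T)"
proof (intro equalityI subsetI)
  fix p assume "p \<in> (R \<odot> S) \<odot> T"
  then show "p \<in> R \<odot> S \<odot> T" by (elim concE) (auto intro!: concI)
next
  fix p assume "p \<in> R \<odot> S \<odot> T"
  then show "p \<in> (R \<odot> S) \<odot> T"
    by (elim concE) (simp, metis append_assoc concI)
qed

lemma conc_Un: "(R \<union> S) \<odot> T = R \<odot> T \<union> S \<odot> T"
  unfolding conc_def by blast

lemma conc_Nil [simp]: "R \<odot> {([], [])} = R" "{([], [])} \<odot> R = R"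
  unfolding conc_def by auto

definition eqlen :: "('a list \<times> 'b list) set \<Rightarrow> bool" where
  "eqlen R \<longleftrightarrow> (\<forall>(u, v)\<in>R. length u = length v)"

text \<open>With equal lengths both components leave \<open>R\<close> at the same moment, so a pair
  of letters lies wholly in \<open>R\<close> or wholly in \<open>S\<close>. The pair
  \<open>(None, None)\<close> must be excluded: it would close \<open>R\<close> while
  \<open>S\<close> is still to be read.\<close>

lemma rderiv_conc:
  assumes "eqlen R" "x \<noteq> None \<or> y \<noteq> None"
  shows "rderiv x y (R \<odot> S) = rderiv x y R \<odot> S \<union> (if ([], []) \<in> R then rderiv x y S else {})"
    (is "?l = ?r")
proof (intro equalityI subsetI)
  fix p assume "p \<in> ?l"
  then obtain u v u' v' where p: "(u, v) \<in> R" "(u', v') \<in> S" "hdo (u @ u') = x" "hdo (v @ v') = y"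
    "p = (tl (u @ u'), tl (v @ v'))"
    by (elim in_rderivE concE) auto
  have len: "length u = length v" using p(1) assms(1) by (auto simp: eqlen_def)
  show "p \<in> ?r"
  proof (cases u)
    case Nil
    then show ?thesis using len p by (auto intro: in_rderivI)
  next
    case (Cons a w)
    with len obtain b w' where v: "v = b # w'" by (cases v) auto
    have "(w, w') \<in> rderiv x y R" using in_rderivI[OF p(1), of x y] p Cons v by simp
    then show ?thesis using p Cons v by (auto intro: concI)
  qed
next
  fix p assume p: "p \<in> ?r"
  show "p \<in> ?l"
  proof (cases "p \<in> rderiv x y R \<odot> S")
    case True
    then obtain u v u' v' where q: "(u, v) \<in> R" "hdo u = x" "hdo v = y" "(u', v') \<in> S"
      "p = (tl u @ u', tl v @ v')"
      by (elim concE in_rderivE) auto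
    have "length u = length v" using q(1) assms(1) by (auto simp: eqlen_def)
    then have "u \<noteq> []" "v \<noteq> []" using q(2,3) assms(2) by auto
    then have "hdo (u @ u') = x" "hdo (v @ v') = y" "p = (tl (u @ u'), tl (v @ v'))"
      using q by (cases u; cases v; simp)+
    then show ?thesis using in_rderivI[OF concI[OF q(1,4)]] by simp
  next
    case False
    then have "([], []) \<in> R" "p \<in> rderiv x y S" using p by (auto split: if_splits)
    then show ?thesis by (elim in_rderivE) (use concI in \<open>fastforce intro!: in_rderivI\<close>)
  qed
qed

lemma eqlen_rderiv: "eqlen R \<Longrightarrow> eqlen (rderiv x y R)"
  unfolding eqlen_def rderiv_def by auto

text \<open>Concatenation does not preserve \<open>autom\<close> in general, since a lag built up in
  the first factor may be unbounded. Quantifying over the right factor singles out the harmless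
  first factors and makes closure under \<open>\<odot>\<close> immediate.\<close>

definition block :: "('a list \<times> 'b list) set \<Rightarrow> bool" where
  "block R \<longleftrightarrow> (\<forall>S. autom S \<longrightarrow> autom (R \<odot> S))"

lemma block_autom: "block R \<Longrightarrow> autom S \<Longrightarrow> autom (R \<odot> S)"
  unfolding block_def by blast

text \<open>In a state \<open>(X, T)\<close>, \<open>X\<close> is what is left of the first factor,
  and \<open>T\<close> holds derivatives of the copies of \<open>S\<close> begun at earlier points
  where the first factor could end.\<close>

lemma autom_eqlen_block:
  assumes "autom R" "eqlen R"
  shows "block R"
  unfolding block_def
proof (intro allI impI)
  fix S :: "('a list \<times> 'b list) set" assume "autom S"
  obtain N where N: "finite N" "R \<in> N" "\<And>X x y. X \<in> N \<Longrightarrow> rderiv x y X \<in> N"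
    using assms(1) by (rule automE) (rule that)
  obtain M where M: "finite M" "S \<in> M" "\<And>X x y. X \<in> M \<Longrightarrow> rderiv x y X \<in> M"
    using \<open>autom S\<close> by (rule automE) (rule that)
  define NN where "NN = N \<inter> {X. eqlen X}"
  let ?g = "\<lambda>(X, T). (X \<odot> S) \<union> \<Union>T"
  have cl: "rderiv x y X \<in> NN" if "X \<in> NN" for X x y
    using that N(3) eqlen_rderiv unfolding NN_def by auto
  show "autom (R \<odot> S)"
  proof (rule automI[of "?g ` (NN \<times> Pow M)"])
    show "R \<odot> S \<in> ?g ` (NN \<times> Pow M)"
      using N(2) assms(2) by (intro image_eqI[of _ _ "(R, {})"]) (auto simp: NN_def)
    fix Z and x :: "'a option" and y :: "'b option"
    assume "Z \<in> ?g ` (NN \<times> Pow M)" and xy: "x \<noteq> None \<or> y \<noteq> None"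
    then obtain X T where Z: "Z = (X \<odot> S) \<union> \<Union>T" "X \<in> NN" "T \<subseteq> M" by auto
    let ?T = "rderiv x y ` T \<union> (if ([], []) \<in> X then {rderiv x y S} else {})"
    have "rderiv x y Z = ?g (rderiv x y X, ?T)"
      using Z(2) unfolding Z(1) rderiv_Un rderiv_Union
      by (subst rderiv_conc) (use xy in \<open>auto simp: NN_def\<close>)
    moreover have "(rderiv x y X, ?T) \<in> NN \<times> Pow M" using cl Z M by auto
    ultimately show "rderiv x y Z \<in> ?g ` (NN \<times> Pow M) \<union> {{}, {([], [])}}" by blast
  qed (use N M in \<open>auto simp: NN_def\<close>)
qed

lemma block_Un: "block R \<Longrightarrow> block S \<Longrightarrow> block (R \<union> S)"
  unfolding block_def by (simp add: conc_Un autom_Un)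

lemma block_conc: "block R \<Longrightarrow> block S \<Longrightarrow> block (R \<odot> S)"
  unfolding block_def by (simp add: conc_assoc)

lemma block_Nil: "block {([], [])}"
  unfolding block_def by simp

text \<open>The left word runs one letter ahead. \<open>cut (x, X)\<close> is \<open>X\<close> with
  the left letter \<open>x\<close> already read and kept in a buffer until its partner arrives; the
  buffer is finite because the left alphabet is.\<close>

lemma block_right:
  "block {([] :: 'a::finite list, [b :: 'b])}"
  unfolding block_def
proof (intro allI impI)
  fix S :: "('a list \<times> 'b list) set" assume "autom S"
  then obtain N where N: "finite N" "S \<in> N" "\<And>X x y. X \<in> N \<Longrightarrow> rderiv x y X \<in> N"
    by (rule automE) (rule that)
  define cut :: "'a option \<times> ('a list \<times> 'b list) set \<Rightarrow> ('a list \<times> 'b list) set"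
    where "cut = (\<lambda>(x, X). {(tl u, v) | u v. (u, v) \<in> X \<and> hdo u = x})"
  have cut: "rderiv x' y (cut (x, X)) = cut (x', rderiv x y X)" for x x' y and X :: "('a list \<times> 'b list) set"
    unfolding cut_def rderiv_def by fastforce
  let ?R = "{([], [b])} \<odot> S"
  have R: "rderiv x y ?R = (if y = Some b then cut (x, S) else {})" for x y
  proof (intro equalityI subsetI)
    fix p assume "p \<in> rderiv x y ?R"
    then show "p \<in> (if y = Some b then cut (x, S) else {})"
      by (elim in_rderivE concE) (auto simp: cut_def)
  next
    fix p assume "p \<in> (if y = Some b then cut (x, S) else {})"
    then obtain u v where "y = Some b" "(u, v) \<in> S" "hdo u = x" "p = (tl u, v)"
      by (auto simp: cut_def split: if_splits)
    then show "p \<in> rderiv x y ?R"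
      using in_rderivI[OF concI[of "[]" "[b]" "{([], [b])}" u v S], of x y] by simp
  qed
  show "autom ?R"
  proof (rule automI[of "insert ?R (cut ` (UNIV \<times> N))"])
    fix X and x :: "'a option" and y :: "'b option"
    assume "X \<in> insert ?R (cut ` (UNIV \<times> N))"
    then show "rderiv x y X \<in> insert ?R (cut ` (UNIV \<times> N)) \<union> {{}, {([], [])}}"
    proof
      assume "X = ?R"
      then show ?thesis using N(2) by (simp add: R)
    next
      assume "X \<in> cut ` (UNIV \<times> N)"
      then obtain z Y where Y: "X = cut (z, Y)" "Y \<in> N" by auto
      then have "rderiv x y X = cut (x, rderiv z y Y)" by (simp only: cut)
      then show ?thesis using N(3)[OF Y(2)] by simp
    qed
  qed (use N in auto)
qed

lemma block_left: "block {([a :: 'a], [] :: 'b::finite list)}"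
  unfolding block_def
proof (intro allI impI)
  fix S :: "('a list \<times> 'b list) set" assume "autom S"
  then have "autom ({([], [a])} \<odot> S\<inverse>)"
    by (intro block_autom block_right autom_converse)
  moreover have "{([a], [])} \<odot> S = ({([], [a])} \<odot> S\<inverse>)\<inverse>"
    unfolding conc_def by auto
  ultimately show "autom ({([a], [])} \<odot> S)" by (simp add: autom_converse)
qed

section \<open>Convolutions and the automaton of derivatives\<close>

lemma conv_Nil [simp]: "conv [] [] = []"
  by (simp add: conv_def)

lemma conv_rec:
  assumes "u \<noteq> [] \<or> v \<noteq> []"
  shows "conv u v = (hdo u, hdo v) # conv (tl u) (tl v)"
proof -
  have "[0..<max (length u) (length v)] = 0 # map Suc [0..<max (length (tl u)) (length (tl v))]"
    using assms by (cases u; cases v) (simp_all add: upt_conv_Cons map_Suc_upt del: upt_Suc)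
  then show ?thesis
    unfolding conv_def by (cases u; cases v) (auto simp: o_def)
qed

lemma conv_eq_Nil_iff: "conv u v = [] \<longleftrightarrow> u = [] \<and> v = []"
  by (cases "u = [] \<and> v = []") (auto simp: conv_rec)

lemma conv_eq_Cons_iff:
  "conv u v = (x, y) # w \<longleftrightarrow> (x \<noteq> None \<or> y \<noteq> None) \<and> hdo u = x \<and> hdo v = y \<and> conv (tl u) (tl v) = w"
  by (cases "u = [] \<and> v = []") (auto simp: conv_rec)

text \<open>No convolution contains \<open>(None, None)\<close>, but \<open>rderiv\<close> would
  keep \<open>([], [])\<close> under it, so this letter is sent to the rejecting sink.\<close>

definition cderiv :: "'a option \<times> 'a option \<Rightarrow> ('a list \<times> 'a list) set \<Rightarrow> ('a list \<times> 'a list) set" where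
  "cderiv p R = (if p = (None, None) then {} else rderiv (fst p) (snd p) R)"

lemma conv_in_iff_fold_cderiv:
  "w \<in> {conv u v | u v. (u, v) \<in> R} \<longleftrightarrow> ([], []) \<in> fold cderiv w R"
proof (induction w arbitrary: R)
  case Nil
  have "(\<exists>u v. [] = conv u v \<and> (u, v) \<in> R) \<longleftrightarrow> ([], []) \<in> R"
    by (metis conv_eq_Nil_iff)
  then show ?case by simp
next
  case (Cons p w)
  obtain x y where p: "p = (x, y)" by force
  have "p # w \<in> {conv u v | u v. (u, v) \<in> R} \<longleftrightarrow> w \<in> {conv u v | u v. (u, v) \<in> cderiv p R}"
    unfolding p cderiv_def rderiv_def by (auto simp: conv_eq_Cons_iff eq_commute[of "_ # _"])
  then show ?case using Cons.IH[of "cderiv p R"] by simp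
qed

lemma autom_regular_lang:
  fixes R :: "('a::finite list \<times> 'a list) set"
  assumes "autom R"
  shows "regular_lang UNIV {conv u v | u v. (u, v) \<in> R}"
proof -
  obtain M where M: "finite M" "R \<in> M" "\<And>X x y. X \<in> M \<Longrightarrow> rderiv x y X \<in> M"
    using assms by (rule automE) (rule that)
  define N where "N = insert {} M"
  have N: "finite N" "R \<in> N" "\<And>X p. X \<in> N \<Longrightarrow> cderiv p X \<in> N"
    using M by (auto simp: N_def cderiv_def rderiv_def)
  \<comment> \<open>States of \<open>regular_lang\<close> are natural numbers, so the derivatives
    are numbered.\<close>
  obtain f :: "_ \<Rightarrow> nat" where f: "inj_on f N"
    using finite_imp_inj_to_nat_seg[OF N(1)] by blast
  define g where "g = inv_into N f"
  have g: "g (f X) = X" if "X \<in> N" for X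
    using that f by (simp add: g_def)
  define delta where "delta = (\<lambda>q p. f (cderiv p (g q)))"
  have fold: "fold (\<lambda>a q. delta q a) w (f X) = f (fold cderiv w X) \<and> fold cderiv w X \<in> N" if "X \<in> N" for w X
    using that by (induction w arbitrary: X) (auto simp: delta_def g N(3))
  have fin: "f X \<in> f ` {Y \<in> N. ([], []) \<in> Y} \<longleftrightarrow> ([], []) \<in> X" if "X \<in> N" for X
    using that f by (auto dest: inj_onD)
  have acc: "w \<in> {conv u v | u v. (u, v) \<in> R} \<longleftrightarrow>
      fold (\<lambda>a q. delta q a) w (f R) \<in> f ` {Y \<in> N. ([], []) \<in> Y}" for w
    unfolding conv_in_iff_fold_cderiv using fold[OF N(2), of w] fin[of "fold cderiv w R"] by simp
  have "\<exists>(Q :: nat set) q0 (delta :: nat \<Rightarrow> _ \<Rightarrow> nat) F.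
        finite Q \<and> q0 \<in> Q \<and> F \<subseteq> Q \<and> (\<forall>q\<in>Q. \<forall>a\<in>UNIV. delta q a \<in> Q) \<and>
        (\<forall>w\<in>lists UNIV. w \<in> {conv u v | u v. (u, v) \<in> R} \<longleftrightarrow> fold (\<lambda>a q. delta q a) w q0 \<in> F)"
    using N acc
    by (intro exI[of _ "f ` N"] exI[of _ "f R"] exI[of _ delta] exI[of _ "f ` {Y \<in> N. ([], []) \<in> Y}"])
       (auto simp: delta_def g)
  then show ?thesis unfolding regular_lang_def by simp
qed

section \<open>Blocks separated by hashes\<close>

fun joinrel :: "('a sym list \<times> 'a sym list) set list \<Rightarrow> ('a sym list \<times> 'a sym list) set" where
  "joinrel [] = {([], [])}"
| "joinrel [B] = B"
| "joinrel (B # Bs) = B \<odot> {([SHash], [SHash])} \<odot> joinrel Bs"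

instance sym :: (finite) finite
proof
  have "(UNIV :: 'a sym set) \<subseteq> {SX, SY, SHash} \<union> range SDig"
    by (metis UNIV_I Un_iff insertCI rangeI subsetI sym.exhaust)
  then show "finite (UNIV :: 'a sym set)"
    by (rule finite_subset) simp
qed

lemma block_hash: "block {([SHash :: 'a::finite sym], [SHash :: 'a sym])}"
proof -
  have "{([SHash], [SHash])} = {([SHash :: 'a sym], [])} \<odot> {([], [SHash :: 'a sym])}"
    by (simp add: conc_def)
  then show ?thesis using block_conc[OF block_left block_right] by metis
qed

text \<open>Only the relations in front of a hash have to be blocks. In the suffix the last relation
  is synthetic division, which may change the length because nothing follows; in the prefix it is
  followed directly by the suffix \<open>Z\<close>.\<close>

lemma autom_joinrel:
  fixes Bs :: "('a::finite sym list \<times> 'a sym list) set list"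
  assumes "\<forall>B\<in>set Bs. block B" "autom (B \<odot> Z)"
  shows "autom (joinrel (Bs @ [B]) \<odot> Z)"
  using assms(1)
proof (induction Bs)
  case (Cons B' Bs)
  have "joinrel ((B' # Bs) @ [B]) = B' \<odot> {([SHash], [SHash])} \<odot> joinrel (Bs @ [B])"
    by (cases Bs) auto
  then show ?case
    using Cons by (auto simp: conc_assoc intro!: block_autom[OF block_hash] block_autom[of B'])
qed (use assms in simp)

lemma joinrel_iff:
  "(u, v) \<in> joinrel Bs \<longleftrightarrow> (\<exists>us vs. u = hash_join us \<and> v = hash_join vs \<and>
     length us = length Bs \<and> length vs = length Bs \<and> (\<forall>k<length Bs. (us ! k, vs ! k) \<in> Bs ! k))"
proof (induction Bs arbitrary: u v rule: joinrel.induct)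
  case (3 B B' Bs)
  let ?C = "B' # Bs"
  show ?case
  proof
    assume "(u, v) \<in> joinrel (B # ?C)"
    then obtain u1 v1 u2 v2 where 1: "(u1, v1) \<in> B" "(u2, v2) \<in> joinrel ?C"
      "u = u1 @ SHash # u2" "v = v1 @ SHash # v2"
      by (auto simp: conc_def)
    then obtain us vs where 2: "u2 = hash_join us" "v2 = hash_join vs" "length us = length ?C"
      "length vs = length ?C" "\<forall>k<length ?C. (us ! k, vs ! k) \<in> ?C ! k"
      using 3 by metis
    have "u = hash_join (u1 # us)" "v = hash_join (v1 # vs)"
      using 1 2 by (cases us; cases vs; simp)+
    moreover have "\<forall>k<length (B # ?C). ((u1 # us) ! k, (v1 # vs) ! k) \<in> (B # ?C) ! k"
      using 1 2 by (auto simp: nth_Cons split: nat.splits)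
    ultimately show "\<exists>us vs. u = hash_join us \<and> v = hash_join vs \<and> length us = length (B # ?C) \<and>
       length vs = length (B # ?C) \<and> (\<forall>k<length (B # ?C). (us ! k, vs ! k) \<in> (B # ?C) ! k)"
      using 2 by (metis length_Cons)
  next
    assume "\<exists>us vs. u = hash_join us \<and> v = hash_join vs \<and> length us = length (B # ?C) \<and>
       length vs = length (B # ?C) \<and> (\<forall>k<length (B # ?C). (us ! k, vs ! k) \<in> (B # ?C) ! k)"
    then obtain us vs where uv: "u = hash_join us" "v = hash_join vs" "length us = length (B # ?C)"
       "length vs = length (B # ?C)" "\<forall>k<length (B # ?C). (us ! k, vs ! k) \<in> (B # ?C) ! k"
      by blast
    then obtain u1 us' v1 vs' where c: "us = u1 # us'" "vs = v1 # vs'"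
      by (metis length_Suc_conv length_Cons)
    have "u = u1 @ SHash # hash_join us'" "v = v1 @ SHash # hash_join vs'"
      using uv c by (cases us'; cases vs'; simp)+
    moreover have "(u1, v1) \<in> B"
      using uv(5) c by auto
    moreover have "\<forall>k<length ?C. (us' ! k, vs' ! k) \<in> ?C ! k"
      using uv(5) c by (metis Suc_less_eq length_Cons nth_Cons_Suc)
    then have "(hash_join us', hash_join vs') \<in> joinrel ?C"
      unfolding 3 using uv(3,4) c by (intro exI[of _ us'] exI[of _ vs']) simp
    ultimately show "(u, v) \<in> joinrel (B # ?C)"
      using concI[of u1 v1 B "SHash # hash_join us'" "SHash # hash_join vs'"]
        concI[of "[SHash]" "[SHash]" "{([SHash], [SHash])}" "hash_join us'" "hash_join vs'"] by simp
  qed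
next
  case (2 B)
  show ?case (is "_ \<longleftrightarrow> ?r")
  proof
    assume "(u, v) \<in> joinrel [B]"
    then show ?r by (intro exI[of _ "[u]"] exI[of _ "[v]"]) simp
  qed (auto simp: length_Suc_conv)
qed simp

section \<open>Relations between digit strings\<close>

hide_const (open) module.smult up_ring.coeff up_ring.monom

text \<open>A digit list without trailing zeros is the same as a polynomial. Coding the polar parts
  this way too turns conditions on strings into polynomial identities.\<close>

definition digs :: "'a::zero poly \<Rightarrow> 'a sym list" where
  "digs C = map SDig (coeffs C)"

lemma digs_0 [simp]: "digs 0 = []"
  by (simp add: digs_def)

lemma digs_pCons [simp]: "pCons c C \<noteq> 0 \<Longrightarrow> digs (pCons c C) = SDig c # digs C"
  by (auto simp: digs_def cCons_def)

lemma digs_inject [simp]: "digs C = digs D \<longleftrightarrow> C = D"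
  by (auto simp: digs_def inj_def coeffs_eq_iff dest: map_injective)

lemma digs_eq_Nil_iff [simp]: "digs C = [] \<longleftrightarrow> C = 0"
  using digs_inject[of C 0] by (simp del: digs_inject)

lemma digs_eq_Cons_iff:
  "digs C = x # w \<longleftrightarrow> (\<exists>c D. C = pCons c D \<and> C \<noteq> 0 \<and> x = SDig c \<and> w = digs D)"
  by (cases C) (metis digs_0 digs_pCons list.distinct(1) list.inject pCons_cases pCons_eq_iff)

definition polyrel :: "('a::zero poly \<Rightarrow> 'a poly \<Rightarrow> bool) \<Rightarrow> ('a sym list \<times> 'a sym list) set" where
  "polyrel P = {(digs A, digs B) | A B. P A B}"

lemma polyrel_iff: "(u, v) \<in> polyrel P \<longleftrightarrow> (\<exists>A B. digs A = u \<and> digs B = v \<and> P A B)"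
  unfolding polyrel_def by blast

lemma polyrel_Cons_iff:
  "(x # u, y # v) \<in> polyrel P \<longleftrightarrow> (\<exists>a b A B. x = SDig a \<and> y = SDig b \<and> u = digs A \<and> v = digs B \<and>
     P (pCons a A) (pCons b B) \<and> pCons a A \<noteq> 0 \<and> pCons b B \<noteq> 0)"
  (is "?l \<longleftrightarrow> ?r")
proof
  assume ?l
  then obtain C D where "digs C = x # u" "digs D = y # v" "P C D" unfolding polyrel_iff by blast
  then show ?r unfolding digs_eq_Cons_iff by blast
next
  assume ?r
  then obtain a b A B where "x = SDig a" "y = SDig b" "u = digs A" "v = digs B"
    "P (pCons a A) (pCons b B)" "pCons a A \<noteq> 0" "pCons b B \<noteq> 0" by blast
  then show ?l
    unfolding polyrel_iff by (intro exI[of _ "pCons a A"] exI[of _ "pCons b B"]) simp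
qed

text \<open>\<open>step\<close> strips one digit from each side and moves inside the finite family
  \<open>P\<close>. \<open>left\<close> lets the left string be at most one digit longer, as
  synthetic division requires; the right one is never longer.\<close>

lemma autom_polyrel:
  fixes P :: "'s::finite \<Rightarrow> 'a::zero poly \<Rightarrow> 'a poly \<Rightarrow> bool"
  assumes step: "\<And>s a b A B. P s (pCons a A) (pCons b B) \<and> pCons a A \<noteq> 0 \<and> pCons b B \<noteq> 0 \<longleftrightarrow>
      ok s a b \<and> P (next s a b) A B"
    and left: "\<And>s A. P s A 0 \<Longrightarrow> Polynomial.degree A = 0"
    and right: "\<And>s B. P s 0 B \<Longrightarrow> B = 0"
  shows "autom (polyrel (P s))"
proof (rule automI[of "range (\<lambda>s. polyrel (P s))"])
  fix X and x y :: "'a sym option"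
  assume "X \<in> range (\<lambda>s. polyrel (P s))" and xy: "x \<noteq> None \<or> y \<noteq> None"
  then obtain s where X: "X = polyrel (P s)" by auto
  have rs: "rderiv (Some (SDig a)) (Some (SDig b)) X = (if ok s a b then polyrel (P (next s a b)) else {})"
    for a b
  proof -
    have "(u, v) \<in> rderiv (Some (SDig a)) (Some (SDig b)) X \<longleftrightarrow>
        (u, v) \<in> (if ok s a b then polyrel (P (next s a b)) else {})" for u v
    proof -
      have "(u, v) \<in> rderiv (Some (SDig a)) (Some (SDig b)) X \<longleftrightarrow> (\<exists>A B. u = digs A \<and> v = digs B \<and>
          (P s (pCons a A) (pCons b B) \<and> pCons a A \<noteq> 0 \<and> pCons b B \<noteq> 0))"
        by (simp add: X polyrel_Cons_iff)
      also have "\<dots> \<longleftrightarrow> (\<exists>A B. u = digs A \<and> v = digs B \<and> ok s a b \<and> P (next s a b) A B)"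
        unfolding step ..
      also have "\<dots> \<longleftrightarrow> (u, v) \<in> (if ok s a b then polyrel (P (next s a b)) else {})"
        by (auto simp: polyrel_def)
      finally show ?thesis .
    qed
    then show ?thesis by auto
  qed
  have ss: "rderiv (Some a) (Some b) X = {}" if "\<not> (\<exists>a' b'. a = SDig a' \<and> b = SDig b')" for a b
    using that by (auto simp: X polyrel_Cons_iff)
  have sn: "rderiv (Some a) None X \<subseteq> {([], [])}" for a
  proof
    fix p assume "p \<in> rderiv (Some a) None X"
    then obtain u where p: "p = (u, [])" "(a # u, []) \<in> X" by (cases p) auto
    then obtain A B where "digs A = a # u" "digs B = []" "P s A B" unfolding X polyrel_iff by blast
    then have A: "digs A = a # u" "P s A 0" by simp_all
    then obtain c D where "A = pCons c D" "u = digs D" by (auto simp: digs_eq_Cons_iff)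
    moreover from this left[OF A(2)] have "D = 0" by (auto split: if_splits)
    ultimately show "p \<in> {([], [])}" using p by simp
  qed
  have ns: "rderiv None (Some b) X = {}" for b
  proof -
    have False if "([], b # v) \<in> X" for v
    proof -
      obtain A B where "digs A = []" "digs B = b # v" "P s A B"
        using \<open>([], b # v) \<in> X\<close> unfolding X polyrel_iff by blast
      then show False using right[of s B] by simp
    qed
    then show ?thesis by auto
  qed
  show "rderiv x y X \<in> range (\<lambda>s. polyrel (P s)) \<union> {{}, {([], [])}}"
  proof (cases x)
    case None
    then show ?thesis using ns xy by (cases y) auto
  next
    case x: (Some a)
    show ?thesis
    proof (cases y)
      case None
      then show ?thesis using sn[of a] x by (metis UnI2 insertI1 insertI2 subset_singletonD)
    next
      case (Some b)
      show ?thesis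
      proof (cases "\<exists>a' b'. a = SDig a' \<and> b = SDig b'")
        case True
        then obtain a' b' where "x = Some (SDig a')" "y = Some (SDig b')" using x Some by auto
        then show ?thesis by (cases "ok s a' b'") (simp_all add: rs)
      next
        case False
        then show ?thesis using ss x Some by simp
      qed
    qed
  qed
qed auto

lemma eqlen_polyrel:
  assumes step: "\<And>s a b A B. P s (pCons a A) (pCons b B) \<and> pCons a A \<noteq> 0 \<and> pCons b B \<noteq> 0 \<longleftrightarrow>
      ok s a b \<and> P (next s a b) A B"
    and left: "\<And>s A. P s A 0 \<Longrightarrow> A = 0"
    and right: "\<And>s B. P s 0 B \<Longrightarrow> B = 0"
  shows "eqlen (polyrel (P s))"
proof -
  have "length (digs A) = length (digs B)" if "P s A B" for A B
    using that
  proof (induction A arbitrary: s B)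
    case 0
    then show ?case using right by auto
  next
    case (pCons a A)
    obtain b C where B: "B = pCons b C" by (cases B)
    have "pCons a A \<noteq> 0" using pCons.hyps by auto
    moreover have "B \<noteq> 0" using pCons.prems left calculation by blast
    ultimately show ?case
      using pCons.prems pCons.IH[of "next s a b" C] step[of s a A b C] unfolding B by simp
  qed
  then show ?thesis by (auto simp: eqlen_def polyrel_def)
qed

text \<open>
  In the relations below the boolean records that the last digit read was 0, so that by the absence of
  trailing zeros a nonzero polynomial must follow.
\<close>

definition diag :: "bool \<Rightarrow> 'a::zero poly \<Rightarrow> 'a poly \<Rightarrow> bool" where
  "diag f A B \<longleftrightarrow> A = B \<and> (f \<longrightarrow> A \<noteq> 0)"

lemma block_diag: "block (polyrel (diag f :: 'a::zero poly \<Rightarrow> _))"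
proof -
  have step: "diag f (pCons a A) (pCons b B) \<and> pCons a A \<noteq> 0 \<and> pCons b B \<noteq> 0 \<longleftrightarrow>
      a = b \<and> diag (a = 0) A B" for f and a b :: 'a and A B
    by (auto simp: diag_def)
  show ?thesis
    by (intro autom_eqlen_block autom_polyrel[of diag, OF step] eqlen_polyrel[of diag, OF step])
       (auto simp: diag_def)
qed

text \<open>Insertion puts \<open>v\<close> in front, except when \<open>v = 0\<close> and
  \<open>A = 0\<close>, where the string stays empty. The flag \<open>v = 0\<close> in
  \<open>diag\<close> removes exactly this case from the concatenation.\<close>

lemma block_insert_digit: "block (polyrel (\<lambda>A B. B = pCons (v :: 'a::{finite,zero}) A))"
proof -
  have "polyrel (\<lambda>A B. B = pCons v A) =
    {([], [SDig v])} \<odot> polyrel (diag (v = 0)) \<union> (if v = 0 then {([], [])} else {})" (is "?l = ?r")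
  proof (intro equalityI subsetI)
    fix p assume "p \<in> ?l"
    then obtain A where p: "p = (digs A, digs (pCons v A))" by (auto simp: polyrel_def)
    show "p \<in> ?r"
    proof (cases "pCons v A = 0")
      case False
      then have "(digs A, digs A) \<in> polyrel (diag (v = 0))" by (auto simp: polyrel_def diag_def)
      from concI[OF _ this, of "[]" "[SDig v]" "{([], [SDig v])}"] show ?thesis
        unfolding p digs_pCons[OF False] by simp
    qed (use p in simp)
  next
    fix p assume p: "p \<in> ?r"
    show "p \<in> ?l"
    proof (cases "p \<in> {([], [SDig v])} \<odot> polyrel (diag (v = 0))")
      case True
      then obtain A where "p = (digs A, SDig v # digs A)" "v = 0 \<longrightarrow> A \<noteq> 0"
        by (auto elim!: concE simp: polyrel_def diag_def)
      moreover from this have "p = (digs A, digs (pCons v A))" by simp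
      ultimately show ?thesis unfolding polyrel_def by blast
    next
      case False
      with p have "v = 0" "p = (digs 0, digs (pCons v 0))" by (auto split: if_splits)
      then show ?thesis unfolding polyrel_def by blast
    qed
  qed
  moreover have "block (if v = 0 then {([], [])} else {} :: ('a sym list \<times> 'a sym list) set)"
    using block_Nil by (simp add: block_def conc_def autom_empty)
  then have "block ?r"
    by (intro block_Un block_conc block_right block_diag)
  ultimately show ?thesis by simp
qed

text \<open>
  With \<open>u = t + a\<close> and \<open>\<delta> = c - a\<close>, dividing \<open>\<Sum> A\<^sub>j u\<^bsup>-j-1\<^esup>\<close> by \<open>t + c = u + \<delta>\<close> gives
  \<open>\<Sum> B\<^sub>j u\<^bsup>-j-1\<^esup>\<close> up to a multiple of \<open>1 / (t + c)\<close>, where \<open>\<delta> B\<^sub>j + B\<^bsub>j+1\<^esub> = A\<^sub>j\<close>.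
  The second component of the state is the expected next digit of \<open>B\<close>.
\<close>

definition chain :: "'a::comm_ring_1 \<Rightarrow> bool \<times> 'a \<Rightarrow> 'a poly \<Rightarrow> 'a poly \<Rightarrow> bool" where
  "chain \<delta> s A B \<longleftrightarrow> (\<exists>B1. B = pCons (snd s) B1 \<and> smult \<delta> B + B1 = A \<and> (fst s \<longrightarrow> A \<noteq> 0))"

lemma invertible_el_mult_eq_0: "invertible_el x \<Longrightarrow> x * y = 0 \<Longrightarrow> y = 0"
  unfolding invertible_el_def by (metis mult.assoc mult.commute mult_1 mult_zero_right)

text \<open>Once \<open>A\<close> is exhausted, the recurrence is
  \<open>B_{j+1} = - \<delta> B_j\<close>, and with \<open>\<delta>\<close> invertible no nonzero
  digit can be the last one. So a wrong guess cannot end together with \<open>A\<close>.\<close>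

lemma chain_0:
  assumes "invertible_el \<delta>" "chain \<delta> s 0 B"
  shows "B = 0"
proof (rule ccontr)
  assume "B \<noteq> 0"
  from assms(2) obtain a B1 where B: "B = pCons a B1" "smult \<delta> B + B1 = 0" by (auto simp: chain_def)
  have "coeff B1 (Polynomial.degree B) = coeff B (Suc (Polynomial.degree B))" using B(1) by simp
  also have "\<dots> = 0" by (simp add: coeff_eq_0)
  finally have "\<delta> * coeff B (Polynomial.degree B) = 0" using B(2) by (metis add.right_neutral coeff_0 coeff_add coeff_smult)
  from invertible_el_mult_eq_0[OF assms(1) this] show False using \<open>B \<noteq> 0\<close> by simp
qed

lemma block_chain:
  fixes \<delta> :: "'a::{finite,comm_ring_1}"
  assumes "invertible_el \<delta>"
  shows "block (polyrel (chain \<delta> s))"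
proof -
  \<comment> \<open>The digit of \<open>B\<close> is forced by the state, and
    \<open>a - \<delta> * b\<close> is the next one. Both strings end together, by
    \<open>left\<close> and \<open>chain_0\<close>.\<close>
  have step: "chain \<delta> s (pCons a A) (pCons b B) \<and> pCons a A \<noteq> 0 \<and> pCons b B \<noteq> 0 \<longleftrightarrow>
      b = snd s \<and> chain \<delta> (a = 0, a - \<delta> * b) A B" for s a b A B
  proof -
    obtain b1 B1 where B: "B = pCons b1 B1" by (cases B)
    show ?thesis unfolding chain_def B by (auto simp: algebra_simps)
  qed
  have left: "A = 0" if "chain \<delta> s A 0" for s A
    using that by (auto simp: chain_def)
  show ?thesis
  proof (rule autom_eqlen_block)
    show "autom (polyrel (chain \<delta> s))"
      by (rule autom_polyrel[of "chain \<delta>", OF step]) (use left chain_0[OF assms] in \<open>fastforce+\<close>)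
    show "eqlen (polyrel (chain \<delta> s))"
      by (rule eqlen_polyrel[of "chain \<delta>", OF step]) (fact left chain_0[OF assms])+
  qed
qed

text \<open>This is \<open>A = (t + c) B + r\<close> read from the constant term upwards.
  \<open>snd s\<close> is the preceding digit of the quotient, with the guessed remainder
  \<open>r\<close> in that place at the start.\<close>

definition synth :: "'a::comm_ring_1 \<Rightarrow> bool \<times> 'a \<Rightarrow> 'a poly \<Rightarrow> 'a poly \<Rightarrow> bool" where
  "synth c s A B \<longleftrightarrow> A = smult c B + pCons (snd s) B \<and> (fst s \<longrightarrow> B \<noteq> 0)"

text \<open>As \<open>t + c\<close> is monic, the leading coefficient of \<open>B\<close> reappears
  one degree higher.\<close>

lemma synth_nonzero: "B \<noteq> 0 \<Longrightarrow> smult c B + pCons r B \<noteq> 0"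
proof
  assume "B \<noteq> 0" "smult c B + pCons r B = 0"
  then have "coeff (smult c B + pCons r B) (Suc (Polynomial.degree B)) = 0" by simp
  then show False using \<open>B \<noteq> 0\<close> by (simp add: coeff_eq_0)
qed

lemma autom_synth: "autom (polyrel (synth (c :: 'a::{finite,comm_ring_1}) s))"
proof (rule autom_polyrel[of "synth c" "\<lambda>s a b. a = c * b + snd s" "\<lambda>s a b. (b = 0, b)"])
  fix s a b and A B :: "'a poly"
  show "synth c s (pCons a A) (pCons b B) \<and> pCons a A \<noteq> 0 \<and> pCons b B \<noteq> 0 \<longleftrightarrow>
      a = c * b + snd s \<and> synth c (b = 0, b) A B"
    using synth_nonzero[of "pCons b B" c "snd s"] by (auto simp: synth_def)
next
  fix s and B :: "'a poly"
  show "B = 0" if "synth c s 0 B"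
    using that synth_nonzero[of B c "snd s"] by (auto simp: synth_def)
qed (auto simp: synth_def)

section \<open>Exponent runs of the prefix\<close>

definition run :: "int \<Rightarrow> 'a sym list" where
  "run z = replicate (nat \<bar>z\<bar>) (if z > 0 then SX else SY)"

lemma ex_nat_split: "(\<exists>n. P n) \<longleftrightarrow> P 0 \<or> (\<exists>n. P (Suc n))"
  by (metis not0_implies_Suc)

lemma block_replicate: "block {(replicate n x, replicate n x) | n. True}"
proof (rule autom_eqlen_block)
  let ?R = "{(replicate n x, replicate n x) | n. True}"
  have ss: "rderiv (Some a) (Some b) ?R = (if a = x \<and> b = x then ?R else {})" for a b
  proof -
    have "(u, v) \<in> rderiv (Some a) (Some b) ?R \<longleftrightarrow> (u, v) \<in> (if a = x \<and> b = x then ?R else {})" for u v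
    proof -
      have "(u, v) \<in> rderiv (Some a) (Some b) ?R \<longleftrightarrow> (\<exists>n. a # u = replicate n x \<and> b # v = replicate n x)"
        by simp
      also have "\<dots> \<longleftrightarrow> (\<exists>n. a = x \<and> b = x \<and> u = replicate n x \<and> v = replicate n x)"
        by (subst ex_nat_split) auto
      finally show ?thesis by auto
    qed
    then show ?thesis unfolding set_eq_iff split_paired_All by blast
  qed
  have "rderiv y z ?R \<in> {?R} \<union> {{}, {([], [])}}" if "y \<noteq> None \<or> z \<noteq> None" for y z
    using that ss by (cases y; cases z) auto
  then show "autom ?R" by (intro automI[of "{?R}"]) auto
qed (auto simp: eqlen_def)

lemma block_run: "block {(run z :: 'a sym list, run z :: 'a sym list) | z. True}"
proof -
  have "{(run z :: 'a sym list, run z :: 'a sym list) | z. True} =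
      {(replicate n SX, replicate n SX) | n. True} \<union> {(replicate n SY, replicate n SY) | n. True}"
    (is "?l = ?r")
  proof (intro equalityI subsetI)
    fix p assume "p \<in> ?r"
    then obtain n where "p = (replicate n SX, replicate n SX) \<or> p = (replicate n SY, replicate n SY)" by auto
    then have "p = (run (int n), run (int n)) \<or> p = (run (- int n), run (- int n))"
      by (auto simp: run_def)
    then show "p \<in> ?l" by blast
  qed (auto simp: run_def split: if_splits)
  moreover have "block ?r"
    by (intro block_Un block_replicate)
  ultimately show ?thesis by (simp only:)
qed

text \<open>For \<open>z \<ge> 0\<close> one \<open>SX\<close> is gained, for \<open>z < 0\<close>
  one \<open>SY\<close> is lost. All letters of a run agree, so the change may be placed at its
  front.\<close>

lemma block_run_Suc: "block {(run z :: 'a::finite sym list, run (z + 1) :: 'a sym list) | z. True}"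
proof -
  have "{(run z :: 'a sym list, run (z + 1) :: 'a sym list) | z. True} =
      {([], [SX])} \<odot> {(replicate n SX, replicate n SX) | n. True} \<union>
      {([SY], [])} \<odot> {(replicate n SY, replicate n SY) | n. True}"
    (is "?l = ?r")
  proof (intro equalityI subsetI)
    fix p assume "p \<in> ?l"
    then obtain z where p: "p = (run z, run (z + 1))" by auto
    show "p \<in> ?r"
    proof (cases "z \<ge> 0")
      case True
      then have "p = (replicate (nat z) SX, SX # replicate (nat z) SX)"
        unfolding p run_def by (auto simp: nat_add_distrib)
      then show ?thesis unfolding conc_def by force
    next
      case False
      then have "p = (SY # replicate (nat (- z - 1)) SY, replicate (nat (- z - 1)) SY)"
        unfolding p run_def by (auto simp flip: replicate_Suc simp del: replicate.simps)
      then show ?thesis unfolding conc_def by force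
    qed
  next
    fix p assume "p \<in> ?r"
    then obtain n where "p = (replicate n SX, SX # replicate n SX) \<or> p = (SY # replicate n SY, replicate n SY)"
      by (auto simp: conc_def)
    then have "p = (run (int n), run (int n + 1)) \<or> p = (run (- int n - 1), run ((- int n - 1) + 1))"
      by (auto simp: run_def nat_add_distrib)
    then show "p \<in> ?l" by blast
  qed
  moreover have "block ?r"
    by (intro block_Un block_conc block_right block_left block_replicate)
  ultimately show ?thesis by (simp only:)
qed

section \<open>Partial fractions\<close>

lemma lin_mult_ex: "\<exists>y. lin a * y = (1 :: 'a::comm_ring_1 fls)"
proof -
  \<comment> \<open>With \<open>X = t^-1\<close>, \<open>t + a = t (1 + a X)\<close>;
    \<open>G\<close> is the geometric series inverting \<open>1 + a X\<close>, so
    \<open>X * G\<close> inverts \<open>t + a\<close>.\<close>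
  define G where "G = Abs_fps (\<lambda>n. (- a) ^ n)"
  have "G + fps_const a * (fps_X * G) = 1"
  proof (rule fps_ext)
    fix n show "fps_nth (G + fps_const a * (fps_X * G)) n = fps_nth 1 n"
      by (cases n) (simp_all add: G_def)
  qed
  then have "fps_to_fls (G + fps_const a * (fps_X * G)) = 1" by simp
  then have "fps_to_fls G + fls_const a * (fls_X * fps_to_fls G) = 1"
    by (simp add: fls_times_fps_to_fls)
  moreover have "fls_X_inv * fls_X = (1 :: 'a fls)"
    by (simp add: fls_X_inv_times_conv_shift)
  then have "fls_X_inv * (fls_X * fps_to_fls G) = fps_to_fls G"
    by (simp flip: mult.assoc)
  ultimately have "lin a * (fls_X * fps_to_fls G) = 1"
    by (simp add: lin_def tt_def algebra_simps)
  then show ?thesis by blast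
qed

lemma lin_linv [simp]: "lin a * linv a = 1"
proof -
  obtain y where y: "lin a * y = 1" using lin_mult_ex by blast
  have "linv a = y"
    unfolding linv_def using y by (rule the_equality) (metis y mult.left_commute mult.right_neutral)
  then show ?thesis using y by simp
qed

lemma linv_lin [simp]: "linv a * lin a = 1"
  by (simp add: mult.commute)

lemma lin_linv_cancel [simp]: "lin a * (linv a * y) = y" "linv a * (lin a * y) = y"
  by (simp_all flip: mult.assoc)

lemma lin_power_linv_power: "lin a ^ n * linv a ^ n = 1"
  by (simp flip: power_mult_distrib)

section \<open>Polynomials evaluated at \<open>t\<close> and at the inverses of
  \<open>t + a\<close>\<close>

definition ev :: "'a::comm_ring_1 poly \<Rightarrow> 'a fls \<Rightarrow> 'a fls" where
  "ev C y = poly (map_poly fls_const C) y"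

lemma ev_0 [simp]: "ev 0 y = 0"
  by (simp add: ev_def)

lemma ev_pCons [simp]: "ev (pCons c C) y = fls_const c + y * ev C y"
  by (simp add: ev_def Polynomial.map_poly_pCons)

lemma ev_1 [simp]: "ev 1 y = 1"
  using ev_pCons[of 1 0 y] by (simp add: one_pCons)

lemma ev_add: "ev (C + D) y = ev C y + ev D y"
  by (induction C D rule: poly_induct2) (simp_all add: algebra_simps flip: fls_plus_const)

lemma ev_smult: "ev (smult c C) y = fls_const c * ev C y"
  by (induction C) (simp_all add: algebra_simps)

lemma ev_mult: "ev (C * D) y = ev C y * ev D y"
  by (induction C) (simp_all add: algebra_simps ev_add ev_smult)

lemma ev_diff: "ev (C - D) y = ev C y - ev D y"
  using ev_add[of "C - D" D y] by simp

lemma ev_power: "ev (C ^ n) y = ev C y ^ n"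
  by (induction n) (simp_all add: ev_mult)

lemma ev_prod: "ev (\<Prod>k\<in>S. C k) y = (\<Prod>k\<in>S. ev (C k) y)"
  by (induction S rule: infinite_finite_induct) (simp_all add: ev_mult)

lemma ev_lin: "ev [:a, 1:] tt = lin a"
  by (simp add: lin_def)

lemma ev_tt_nth: "fls_nth (ev P tt) m = (if m \<le> 0 then coeff P (nat (- m)) else 0)"
proof (induction P arbitrary: m)
  case (pCons c C)
  have "fls_nth (ev (pCons c C) tt) m = (if m = 0 then c else 0) + fls_nth (ev C tt) (m + 1)"
    by (simp add: tt_def fls_X_inv_times_conv_shift)
  also have "\<dots> = (if m \<le> 0 then coeff (pCons c C) (nat (- m)) else 0)"
  proof (cases "m < 0")
    case True
    then have "nat (- m) = Suc (nat (- (m + 1)))" by simp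
    with True show ?thesis by (simp add: pCons.IH)
  qed (simp add: pCons.IH)
  finally show ?case .
qed simp

lemma ev_tt_inject [simp]: "ev P tt = ev Q tt \<longleftrightarrow> P = Q"
proof
  assume eq: "ev P tt = ev Q tt"
  show "P = Q"
  proof (rule poly_eqI)
    fix n
    have "fls_nth (ev P tt) (- int n) = fls_nth (ev Q tt) (- int n)" using eq by simp
    then show "coeff P n = coeff Q n" by (simp add: ev_tt_nth)
  qed
qed simp

lemma poly_fls_eq_ev: "poly_fls P = ev P tt"
proof -
  have "Polynomial.degree (map_poly fls_const P) = Polynomial.degree P"
    by (rule degree_map_poly) simp
  then show ?thesis
    unfolding poly_fls_def ev_def poly_altdef by (simp add: coeff_map_poly)
qed

text \<open>The principal part at \<open>t = -a\<close>. The factor \<open>linv a\<close> in front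
  makes the constant coefficient of \<open>C\<close> the digit of degree -1.\<close>

definition pole_part :: "'a::comm_ring_1 \<Rightarrow> 'a poly \<Rightarrow> 'a fls" where
  "pole_part a C = linv a * ev C (linv a)"

lemma pole_part_0 [simp]: "pole_part a 0 = 0"
  by (simp add: pole_part_def)

lemma lin_pole_part_pCons: "lin a * pole_part a (pCons c C) = fls_const c + pole_part a C"
  by (simp add: pole_part_def)

lemma pole_part_coeffs: "pole_part a C = (\<Sum>j<length (coeffs C). fls_const (coeffs C ! j) * linv a ^ (j + 1))"
proof (induction C)
  case (pCons c C)
  then have "coeffs (pCons c C) = c # coeffs C" by (simp add: cCons_def) (metis coeffs_eq_Nil)
  moreover have "pole_part a (pCons c C) = fls_const c * linv a + linv a * pole_part a C"
    by (simp add: pole_part_def algebra_simps)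
  ultimately show ?case
    by (simp only: length_Cons sum.lessThan_Suc_shift pCons.IH nth_Cons_0 nth_Cons_Suc sum_distrib_left)
      (simp add: algebra_simps)
qed simp

lemma pole_part_clear: "\<exists>N Q. lin a ^ N * pole_part a C = ev Q tt"
proof (induction C)
  case 0
  show ?case by (intro exI[of _ 0]) simp
next
  case (pCons c C)
  then obtain N Q where NQ: "lin a ^ N * pole_part a C = ev Q tt" by blast
  have "lin a ^ Suc N * pole_part a (pCons c C) = lin a ^ N * (lin a * pole_part a (pCons c C))"
    by (simp add: algebra_simps)
  also have "\<dots> = ev (smult c ([:a, 1:] ^ N) + Q) tt"
    unfolding lin_pole_part_pCons ev_add ev_smult ev_power ev_lin NQ[symmetric] by (simp add: algebra_simps)
  finally show ?case by blast
qed

text \<open>Clearing denominators serves twice: over all poles but one, to isolate a single pole,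
  and over all poles, to place \<open>val l C\<close> in \<open>Rd l\<close>.\<close>

lemma pole_sum_clear:
  assumes "finite S"
  shows "\<exists>n Q. (\<Prod>k\<in>S. lin (l k) ^ n k) * (\<Sum>k\<in>S. pole_part (l k) (C k)) = ev Q tt"
  using assms
proof (induction S rule: finite_induct)
  case empty
  have "(\<Prod>k\<in>{}. lin (l k) ^ n k) * (\<Sum>k\<in>{}. pole_part (l k) (C k)) = ev 0 tt" for n
    by simp
  then show ?case by blast
next
  case (insert x S)
  then obtain n Q where Q: "(\<Prod>k\<in>S. lin (l k) ^ n k) * (\<Sum>k\<in>S. pole_part (l k) (C k)) = ev Q tt" by blast
  obtain N A where A: "lin (l x) ^ N * pole_part (l x) (C x) = ev A tt" using pole_part_clear by blast
  let ?n = "n(x := N)"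
  have p: "(\<Prod>k\<in>S. lin (l k) ^ ?n k) = (\<Prod>k\<in>S. lin (l k) ^ n k)"
    using insert by (intro prod.cong) auto
  have "(\<Prod>k\<in>insert x S. lin (l k) ^ ?n k) * (\<Sum>k\<in>insert x S. pole_part (l k) (C k)) =
      (\<Prod>k\<in>S. lin (l k) ^ n k) * (lin (l x) ^ N * pole_part (l x) (C x)) +
      lin (l x) ^ N * ((\<Prod>k\<in>S. lin (l k) ^ n k) * (\<Sum>k\<in>S. pole_part (l k) (C k)))"
    by (simp only: prod.insert[OF insert(1,2)] sum.insert[OF insert(1,2)] p fun_upd_same)
       (simp add: algebra_simps)
  also have "\<dots> = ev ((\<Prod>k\<in>S. [:l k, 1:] ^ n k) * A + [:l x, 1:] ^ N * Q) tt"
    unfolding A Q ev_add ev_mult ev_prod ev_power ev_lin ..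
  finally show ?case by blast
qed

section \<open>Uniqueness of partial fractions\<close>

lemma invertible_el_1: "invertible_el 1"
  unfolding invertible_el_def by (rule exI[of _ 1]) simp

lemma invertible_el_mult: "invertible_el x \<Longrightarrow> invertible_el y \<Longrightarrow> invertible_el (x * y)"
  unfolding invertible_el_def by (metis mult.assoc mult.left_commute mult.right_neutral)

lemma invertible_el_power: "invertible_el x \<Longrightarrow> invertible_el (x ^ n)"
  by (induction n) (simp_all add: invertible_el_1 invertible_el_mult)

lemma invertible_el_prod: "(\<And>k. k \<in> S \<Longrightarrow> invertible_el (f k)) \<Longrightarrow> invertible_el (prod f S)"
  by (induction S rule: infinite_finite_induct) (simp_all add: invertible_el_1 invertible_el_mult)

text \<open>Multiplying by \<open>t + a\<close> detaches the first digit \<open>c\<close> and leaves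
  a relation of the same kind for the remaining digits, which vanish by induction. Then
  \<open>(t + a) A = c D\<close>, and evaluation at \<open>-a\<close> gives
  \<open>c D(-a) = 0\<close> with \<open>D(-a)\<close> a unit.\<close>

lemma pole_part_polynomial_imp_0:
  assumes "invertible_el (poly D (- a))" "ev D tt * pole_part a C = ev A tt"
  shows "C = 0"
  using assms(2)
proof (induction C arbitrary: A)
  case (pCons c C)
  have "lin a * ev A tt = ev D tt * (lin a * pole_part a (pCons c C))"
    unfolding pCons.prems[symmetric] by (simp only: mult.left_commute)
  also have "\<dots> = fls_const c * ev D tt + ev D tt * pole_part a C"
    unfolding lin_pole_part_pCons by (simp add: algebra_simps)
  finally have eq: "ev ([:a, 1:] * A) tt = ev (smult c D) tt + ev D tt * pole_part a C"
    by (simp only: ev_mult ev_lin ev_smult)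
  then have "ev D tt * pole_part a C = ev ([:a, 1:] * A - smult c D) tt"
    by (simp only: ev_diff) simp
  then have C: "C = 0" by (rule pCons.IH)
  with eq have "[:a, 1:] * A = smult c D" by simp
  then have "poly (smult c D) (- a) = poly ([:a, 1:] * A) (- a)" by simp
  also have "\<dots> = 0" by (simp only: poly_mult) simp
  finally have "poly (smult c D) (- a) = 0" .
  then have "c = 0"
    using invertible_el_mult_eq_0[OF assms(1)] by (simp add: mult.commute)
  with C show ?case by simp
qed simp

text \<open>The entry of \<open>C\<close> at index \<open>length l\<close> is the polynomial part, the earlier ones are the polar parts.\<close>

definition val :: "'a::comm_ring_1 list \<Rightarrow> (nat \<Rightarrow> 'a poly) \<Rightarrow> 'a fls" where
  "val l C = (\<Sum>k<length l. pole_part (l ! k) (C k)) + ev (C (length l)) tt"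

lemma pole_part_diff: "pole_part a (C - D) = pole_part a C - pole_part a D"
  by (simp add: pole_part_def ev_diff algebra_simps)

lemma val_diff: "val l (\<lambda>k. C k - D k) = val l C - val l D"
  by (simp add: val_def pole_part_diff ev_diff sum_subtractf)

locale unit_differences =
  fixes l :: "'a::comm_ring_1 list"
  assumes units: "i < length l \<Longrightarrow> j < length l \<Longrightarrow> i \<noteq> j \<Longrightarrow> invertible_el (l ! i - l ! j)"
begin

text \<open>Clearing the denominators of all poles except \<open>-l_k\<close> makes the polar part
  there a polynomial. The multiplier takes at \<open>-l_k\<close> a product of powers of
  \<open>l_j - l_k\<close>, a unit. With all polar parts gone, the polynomial part vanishes as
  well.\<close>

lemma val_eq_0D:
  assumes "val l C = 0" "k \<le> length l"
  shows "C k = 0"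
proof -
  have less: "C k = 0" if k: "k < length l" for k
  proof -
    let ?S = "{..<length l} - {k}"
    obtain n Q where Q: "(\<Prod>j\<in>?S. lin (l ! j) ^ n j) * (\<Sum>j\<in>?S. pole_part (l ! j) (C j)) = ev Q tt"
      using pole_sum_clear[of ?S "\<lambda>j. l ! j" C] by auto
    let ?D = "\<Prod>j\<in>?S. [:l ! j, 1:] ^ n j"
    have D: "ev ?D tt = (\<Prod>j\<in>?S. lin (l ! j) ^ n j)"
      by (simp only: ev_prod ev_power ev_lin)
    have "(\<Sum>j<length l. pole_part (l ! j) (C j)) = pole_part (l ! k) (C k) + (\<Sum>j\<in>?S. pole_part (l ! j) (C j))"
      using k by (intro sum.remove) auto
    then have "pole_part (l ! k) (C k) = - (\<Sum>j\<in>?S. pole_part (l ! j) (C j)) - ev (C (length l)) tt"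
      using assms(1) unfolding val_def by (simp add: algebra_simps eq_neg_iff_add_eq_0)
    then have "ev ?D tt * pole_part (l ! k) (C k) = 0 - ev ?D tt * (\<Sum>j\<in>?S. pole_part (l ! j) (C j))
        - ev ?D tt * ev (C (length l)) tt"
      by (simp only: right_diff_distrib minus_mult_right diff_0)
    also have "\<dots> = ev (0 - Q - ?D * C (length l)) tt"
      unfolding D Q by (simp only: ev_diff ev_mult D ev_0)
    finally have "ev ?D tt * pole_part (l ! k) (C k) = ev (0 - Q - ?D * C (length l)) tt" .
    moreover have "poly ?D (- (l ! k)) = (\<Prod>j\<in>?S. (l ! j - l ! k) ^ n j)"
      by (simp add: poly_prod)
    then have "invertible_el (poly ?D (- (l ! k)))"
      using k by (auto intro!: invertible_el_prod invertible_el_power units)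
    ultimately show ?thesis by (intro pole_part_polynomial_imp_0)
  qed
  show ?thesis
  proof (cases "k = length l")
    case True
    have "ev (C (length l)) tt = ev 0 tt" using assms(1) less by (simp add: val_def)
    then show ?thesis unfolding True ev_tt_inject .
  qed (use less assms(2) in simp)
qed

lemma val_inject:
  assumes "val l C = val l D" "k \<le> length l"
  shows "C k = D k"
  using val_eq_0D[of "\<lambda>k. C k - D k" k] assms by (simp add: val_diff)

text \<open>This evaluates the definite description in \<open>decomp\<close>; its uniqueness half is
  \<open>val_inject\<close>.\<close>

lemma decomp_val:
  "decomp l (val l C) = (map (\<lambda>k. coeffs (C k)) [0..<length l], C (length l))"
  unfolding decomp_def
proof (rule the_equality, goal_cases)
  case 1
  show ?case
    by (auto simp: val_def pole_part_coeffs poly_fls_eq_ev last_coeffs_eq_coeff_degree)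
next
  case (2 p)
  obtain cs P where p: "p = (cs, P)" by force
  from 2 have cs: "length cs = length l" "\<And>c. c \<in> set cs \<Longrightarrow> c = [] \<or> last c \<noteq> 0"
    and eq: "val l C = (\<Sum>k<length l. \<Sum>j<length (cs ! k). fls_const (cs ! k ! j) * linv (l ! k) ^ (j + 1))
           + poly_fls P"
    unfolding p by auto
  \<comment> \<open>A rival decomposition is read as a family of polynomials; the ban on trailing
    zeros makes \<open>coeffs\<close> undo \<open>Poly\<close>.\<close>
  define D where "D = (\<lambda>k. if k < length l then Poly (cs ! k) else P)"
  have co: "coeffs (D k) = cs ! k" if "k < length l" for k
  proof -
    have "cs ! k \<in> set cs" using that cs by simp
    then have "no_trailing (HOL.eq 0) (cs ! k)"
      using cs(2)[of "cs ! k"] by (auto simp: no_trailing_unfold)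
    then show ?thesis using that by (simp add: D_def)
  qed
  have "val l D = val l C"
    unfolding eq by (simp add: val_def pole_part_coeffs co poly_fls_eq_ev) (simp add: D_def)
  then have DC: "D k = C k" if "k \<le> length l" for k
    using that by (rule val_inject)
  have "cs = map (\<lambda>k. coeffs (C k)) [0..<length l]"
    using cs co DC by (intro nth_equalityI) (auto simp: less_imp_le)
  moreover have "P = C (length l)" using DC[of "length l"] by (simp add: D_def)
  ultimately show ?case by (simp add: p)
qed

end

section \<open>Units and membership in \<open>Rd\<close>\<close>

lemma prod_lin_linv_power: "(\<Prod>k\<in>S. lin (a k) ^ n k) * (\<Prod>k\<in>S. linv (a k) ^ n k) = 1"
  by (simp add: lin_power_linv_power flip: prod.distrib)

lemma in_RdI:
  assumes "(\<Prod>k<length l. lin (l ! k) ^ n k) * R = ev P tt"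
  shows "R \<in> Rd l"
proof -
  let ?U = "\<Prod>k<length l. lin (l ! k) ^ n k" and ?V = "\<Prod>k<length l. linv (l ! k) ^ n k"
  have "R = (?U * ?V) * R" by (simp only: prod_lin_linv_power mult_1)
  also have "\<dots> = poly_fls P * ?V"
    unfolding poly_fls_eq_ev assms[symmetric] by (simp only: ac_simps)
  finally show ?thesis unfolding Rd_def by blast
qed

lemma val_in_Rd: "val l C \<in> Rd l"
proof -
  obtain n Q where Q: "(\<Prod>k<length l. lin (l ! k) ^ n k) * (\<Sum>k<length l. pole_part (l ! k) (C k)) = ev Q tt"
    using pole_sum_clear[of "{..<length l}" "\<lambda>k. l ! k" C] by auto
  show ?thesis
  proof (rule in_RdI)
    show "(\<Prod>k<length l. lin (l ! k) ^ n k) * val l C =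
        ev (Q + (\<Prod>k<length l. [:l ! k, 1:] ^ n k) * C (length l)) tt"
      unfolding val_def distrib_left Q ev_add ev_mult ev_prod ev_power ev_lin ..
  qed
qed

lemma lpow_plus_1: "lpow a (z + 1) = lin a * lpow a z"
proof (cases "z \<ge> 0")
  case True
  then show ?thesis by (simp add: lpow_def nat_add_distrib)
next
  case False
  then obtain n where z: "z = - int (Suc n)"
    by (metis int_cases not_le_imp_less of_nat_0_le_iff)
  then have "lpow a (z + 1) = linv a ^ n" "lpow a z = linv a ^ Suc n"
    by (auto simp: lpow_def nat_add_distrib)
  then show ?thesis by simp
qed

lemma lpow_uminus: "lpow a z * lpow a (- z) = 1"
  unfolding lpow_def by (auto simp: lin_power_linv_power mult.commute[of "linv a ^ n" for n])

lemma Ufac_uminus: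
  assumes "length m = length l"
  shows "Ufac l m * Ufac l (map uminus m) = 1"
  using assms by (simp add: Ufac_def lpow_uminus flip: prod.distrib)

lemma Ufac_update:
  assumes "length m = length l" "i < length l"
  shows "Ufac l (m[i := m ! i + 1]) = lin (l ! i) * Ufac l m"
proof -
  have "Ufac l m' = lpow (l ! i) (m' ! i) * (\<Prod>k\<in>{..<length l} - {i}. lpow (l ! k) (m' ! k))" for m'
    unfolding Ufac_def using assms(2) by (intro prod.remove) auto
  note remove = this
  have "(\<Prod>k\<in>{..<length l} - {i}. lpow (l ! k) (m[i := m ! i + 1] ! k)) =
      (\<Prod>k\<in>{..<length l} - {i}. lpow (l ! k) (m ! k))"
    by (intro prod.cong) auto
  then show ?thesis
    unfolding remove[of m] remove[of "m[i := m ! i + 1]"] using assms by (simp add: lpow_plus_1 mult.assoc)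
qed

lemma Ufac_uminus_update:
  assumes "length m = length l" "i < length l"
  shows "Ufac l (map uminus (m[i := m ! i + 1])) = linv (l ! i) * Ufac l (map uminus m)"
proof -
  let ?m = "m[i := m ! i + 1]"
  have "Ufac l (map uminus m) = Ufac l (map uminus m) * (lin (l ! i) * Ufac l m * Ufac l (map uminus ?m))"
    using Ufac_uminus[of ?m l] assms by (simp add: Ufac_update)
  also have "\<dots> = (Ufac l m * Ufac l (map uminus m)) * (lin (l ! i) * Ufac l (map uminus ?m))"
    by (simp only: ac_simps)
  also have "\<dots> = lin (l ! i) * Ufac l (map uminus ?m)"
    by (simp only: Ufac_uminus[OF assms(1)] mult_1)
  finally show ?thesis by simp
qed

lemma lpow_cases: "\<exists>p n. lpow a z = lin a ^ p * linv a ^ n"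
  unfolding lpow_def by (metis mult.left_neutral mult.right_neutral power_0)

lemma Ufac_mult_Rd:
  assumes "R \<in> Rd l"
  shows "Ufac l m * R \<in> Rd l"
proof -
  from assms obtain P n where R: "R = poly_fls P * (\<Prod>k<length l. linv (l ! k) ^ n k)"
    unfolding Rd_def by blast
  have "\<forall>k. \<exists>p q. lpow (l ! k) (m ! k) = lin (l ! k) ^ p * linv (l ! k) ^ q"
    using lpow_cases by blast
  then obtain p q where pq: "\<And>k. lpow (l ! k) (m ! k) = lin (l ! k) ^ p k * linv (l ! k) ^ q k"
    by metis
  have "Ufac l m * R = poly_fls ((\<Prod>k<length l. [:l ! k, 1:] ^ p k) * P) *
      (\<Prod>k<length l. linv (l ! k) ^ (q k + n k))"
    unfolding Ufac_def R pq poly_fls_eq_ev ev_mult ev_prod ev_power ev_lin prod.distrib power_add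
    by (simp only: ac_simps)
  then show ?thesis unfolding Rd_def by (intro CollectI exI conjI TrueI)
qed

section \<open>Division of the partial fractions by \<open>t + c\<close>\<close>

lemma chain_pole_part:
  assumes "chain (c - a) s A B"
  shows "pole_part a B = linv c * pole_part a A + fls_const (snd s) * linv c"
proof -
  from assms obtain B1 where B: "B = pCons (snd s) B1" "A = smult (c - a) B + B1"
    by (auto simp: chain_def)
  \<comment> \<open>Multiplying the polar part of \<open>B\<close> by \<open>lin a\<close> shifts
    its digits and releases the first one as a constant. After division by \<open>t + c\<close> that
    constant becomes a residue at \<open>-c\<close>.\<close>
  have "pole_part a A + fls_const (snd s) = fls_const (c - a) * pole_part a B + lin a * pole_part a B"
    unfolding B(2) pole_part_def ev_add ev_smult
    by (subst (2) B(1)) (simp add: algebra_simps pole_part_def)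
  also have "\<dots> = lin c * pole_part a B"
    by (simp add: lin_def algebra_simps flip: fls_plus_const fls_minus_const)
  finally have "linv c * (pole_part a A + fls_const (snd s)) = pole_part a B" by simp
  then show ?thesis by (simp add: algebra_simps)
qed

lemma synth_ev:
  assumes "synth c s A B"
  shows "ev B tt = linv c * ev A tt - fls_const (snd s) * linv c"
proof -
  have "ev A tt = fls_const (snd s) + lin c * ev B tt"
    using assms by (simp add: synth_def ev_add ev_smult lin_def algebra_simps)
  then show ?thesis by (simp add: algebra_simps)
qed

lemma pole_part_pCons: "pole_part c (pCons v A) = linv c * pole_part c A + fls_const v * linv c"
  by (simp add: pole_part_def algebra_simps)

text \<open>Induction on \<open>A\<close> solves the recurrence from the last digit back: the new
  first digit is the solution \<open>x\<close> of \<open>\<delta> x + a = c\<close>.\<close>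

lemma chain_ex:
  assumes "invertible_el \<delta>"
  shows "\<exists>a B. chain \<delta> (False, a) A B"
proof (induction A)
  case 0
  have "chain \<delta> (False, 0) 0 0" by (auto simp: chain_def)
  then show ?case by blast
next
  case (pCons c A)
  then obtain a B1 where B: "smult \<delta> (pCons a B1) + B1 = A" by (auto simp: chain_def)
  obtain \<epsilon> where e: "\<delta> * \<epsilon> = 1" using assms unfolding invertible_el_def by blast
  have "chain \<delta> (False, \<epsilon> * (c - a)) (pCons c A) (pCons (\<epsilon> * (c - a)) (pCons a B1))"
    using B e by (simp add: chain_def flip: mult.assoc)
  then show ?case by blast
qed

text \<open>Horner's scheme from the top degree down: the old remainder becomes a quotient digit,
  and \<open>a - c * r\<close> is the new remainder.\<close>

lemma synth_ex: "\<exists>r B. synth c (False, r) A B"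
proof (induction A)
  case 0
  have "synth c (False, 0) 0 0" by (auto simp: synth_def)
  then show ?case by blast
next
  case (pCons a A)
  then obtain r B where "A = smult c B + pCons r B" by (auto simp: synth_def)
  then have "synth c (False, a - c * r) (pCons a A) (pCons r B)"
    by (simp add: synth_def)
  then show ?case by blast
qed

section \<open>The relation of a generator on normal forms\<close>

text \<open>
  The guessed residues: \<open>a ! k\<close> is what division by \<open>t + l_i\<close> moves from the pole \<open>-l_k\<close> to \<open>-l_i\<close>, and
  \<open>r\<close> is the remainder of the polynomial part.
\<close>

definition srel :: "'a::comm_ring_1 list \<Rightarrow> nat \<Rightarrow> 'a \<Rightarrow> 'a list \<Rightarrow> 'a \<Rightarrow> nat \<Rightarrow> 'a poly \<Rightarrow> 'a poly \<Rightarrow> bool" where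
  "srel l i b a r k = (if k = length l then synth (l ! i) (False, r)
     else if k = i then (\<lambda>A B. B = pCons (b + r - (\<Sum>j\<in>{..<length l} - {i}. a ! j)) A)
     else chain (l ! i - l ! k) (False, a ! k))"

lemma fls_const_sum: "fls_const (sum f S) = (\<Sum>k\<in>S. fls_const (f k))"
  by (induction S rule: infinite_finite_induct) (simp_all flip: fls_plus_const)

text \<open>Three sources feed the new simple pole at \<open>-l_i\<close>: the constant
  \<open>b\<close>, the remainder \<open>r\<close>, and, with a minus sign, the first new digit at
  every other pole. Their total is the digit that \<open>srel\<close> inserts there.\<close>

lemma srel_val:
  assumes i: "i < length l" and C: "\<And>k. k \<le> length l \<Longrightarrow> srel l i b a r k (C k) (C' k)"
  shows "val l C' = linv (l ! i) * (val l C + fls_const b)"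
proof -
  let ?c = "l ! i" and ?S = "{..<length l} - {i}"
  have rem: "(\<Sum>k<length l. pole_part (l ! k) (D k)) = pole_part ?c (D i) + (\<Sum>k\<in>?S. pole_part (l ! k) (D k))" for D
    using i by (intro sum.remove) auto
  have "(\<Sum>k\<in>?S. pole_part (l ! k) (C' k)) =
      (\<Sum>k\<in>?S. linv ?c * pole_part (l ! k) (C k) + fls_const (a ! k) * linv ?c)"
  proof (rule sum.cong)
    fix k assume "k \<in> ?S"
    then have "chain (?c - l ! k) (False, a ! k) (C k) (C' k)" using C[of k] by (simp add: srel_def)
    from chain_pole_part[OF this]
    show "pole_part (l ! k) (C' k) = linv ?c * pole_part (l ! k) (C k) + fls_const (a ! k) * linv ?c" by simp
  qed simp
  then have 1: "(\<Sum>k\<in>?S. pole_part (l ! k) (C' k)) =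
      linv ?c * (\<Sum>k\<in>?S. pole_part (l ! k) (C k)) + fls_const (\<Sum>k\<in>?S. a ! k) * linv ?c"
    by (simp add: sum.distrib sum_distrib_left sum_distrib_right fls_const_sum)
  have "C' i = pCons (b + r - (\<Sum>k\<in>?S. a ! k)) (C i)" using C[of i] i by (simp add: srel_def)
  then have 2: "pole_part ?c (C' i) = linv ?c * pole_part ?c (C i) +
      (fls_const b + fls_const r - fls_const (\<Sum>k\<in>?S. a ! k)) * linv ?c"
    by (simp add: pole_part_pCons fls_plus_const fls_minus_const)
  have "synth ?c (False, r) (C (length l)) (C' (length l))" using C[of "length l"] by (simp add: srel_def)
  from synth_ev[OF this] have 3: "ev (C' (length l)) tt = linv ?c * ev (C (length l)) tt - fls_const r * linv ?c"
    by simp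
  show ?thesis
    unfolding val_def rem 1 2 3 by (simp add: algebra_simps)
qed

section \<open>Unique readability of normal forms\<close>

lemma takeWhile_append_inject:
  assumes "u @ z = v @ z'" "\<forall>x\<in>set u. P x" "\<forall>x\<in>set v. P x"
    "z = [] \<or> \<not> P (hd z)" "z' = [] \<or> \<not> P (hd z')"
  shows "u = v \<and> z = z'"
proof -
  have "takeWhile P (w @ y) = w" if "\<forall>x\<in>set w. P x" "y = [] \<or> \<not> P (hd y)" for w y
    using that by (cases y) auto
  then have "u = v" using assms by metis
  then show ?thesis using assms(1) by simp
qed

text \<open>Prefix and suffix meet without a separator, so the cut has to come from the alphabet:
  \<open>P\<close> holds inside the blocks and fails for the hash and for the first letter of the
  rest. The number of blocks is known.\<close>

lemma hash_join_append_inject: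
  assumes "length us = length vs" "us \<noteq> []" "hash_join us @ z = hash_join vs @ z'"
    "\<forall>u\<in>set us. \<forall>x\<in>set u. P x" "\<forall>v\<in>set vs. \<forall>x\<in>set v. P x" "\<not> P SHash"
    "z = [] \<or> \<not> P (hd z)" "z' = [] \<or> \<not> P (hd z')"
  shows "us = vs \<and> z = z'"
  using assms(1-5)
proof (induction us vs rule: list_induct2)
  case (Cons u us v vs)
  show ?case
  proof (cases us)
    case Nil
    with Cons.hyps have "vs = []" by simp
    with Nil show ?thesis
      using takeWhile_append_inject[of u z v z' P] Cons.prems assms(7,8) by simp
  next
    case us: (Cons u' us')
    with Cons.hyps obtain v' vs' where vs: "vs = v' # vs'" by (cases vs) auto
    have "u @ SHash # hash_join us @ z = v @ SHash # hash_join vs @ z'"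
      using Cons.prems us vs by simp
    then have "u = v \<and> SHash # hash_join us @ z = SHash # hash_join vs @ z'"
      by (intro takeWhile_append_inject[of _ _ _ _ P]) (use Cons.prems assms(6) in auto)
    then have "u = v" "hash_join us @ z = hash_join vs @ z'" by simp_all
    moreover from this(2) have "us = vs \<and> z = z'"
      by (intro Cons.IH) (use Cons.prems(3,4) us in auto)
    ultimately show ?thesis by simp
  qed
qed simp

lemma set_hash_join: "set (hash_join ws) \<subseteq> insert SHash (\<Union>w\<in>set ws. set w)"
  by (induction ws rule: hash_join.induct) auto

lemma run_inject: "run z = run z' \<longleftrightarrow> z = z'"
  by (auto simp: run_def replicate_eq_replicate split: if_splits)

lemma set_run: "set (run z) \<subseteq> {SX, SY}"
  by (auto simp: run_def)

definition code :: "int list \<Rightarrow> nat \<Rightarrow> (nat \<Rightarrow> 'a::zero poly) \<Rightarrow> 'a sym list" where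
  "code m n C = hash_join (map run m) @ hash_join (map (\<lambda>k. digs (C k)) [0..<Suc n])"

text \<open>The suffix starts with a digit or a hash, so the letters \<open>SX\<close> and
  \<open>SY\<close> locate the end of the prefix. A second cut, at hashes only, separates the digit
  blocks.\<close>

lemma code_inject:
  assumes "code m n C = code m' n C'" "length m = length m'" "m \<noteq> []"
  shows "m = m'" "\<And>k. k \<le> n \<Longrightarrow> C k = C' k"
proof -
  let ?P = "\<lambda>x :: 'a sym. x \<in> {SX, SY}" and ?z = "\<lambda>C :: nat \<Rightarrow> 'a poly. hash_join (map (\<lambda>k. digs (C k)) [0..<Suc n])"
  have z: "?z C = [] \<or> \<not> ?P (hd (?z C))" for C
  proof (cases "?z C = []")
    case False
    then have "hd (?z C) \<in> insert SHash (\<Union>w\<in>set (map (\<lambda>k. digs (C k)) [0..<Suc n]). set w)"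
      using set_hash_join hd_in_set by blast
    then show ?thesis by (auto simp: digs_def)
  qed simp
  have join: "(map run m :: 'a sym list list) = map run m' \<and> ?z C = ?z C'"
  proof (rule hash_join_append_inject[where P = ?P, OF _ _ _ _ _ _ z z])
    have "\<forall>u\<in>set (map run m). \<forall>x\<in>set u. ?P x" for m
      using set_run by fastforce
    then show "\<forall>u\<in>set (map run m). \<forall>x\<in>set u. ?P x" "\<forall>u\<in>set (map run m'). \<forall>x\<in>set u. ?P x"
      by blast+
  qed (use assms in \<open>auto simp: code_def\<close>)
  have "inj (run :: int \<Rightarrow> 'a sym list)"
    by (simp add: inj_def run_inject)
  with join show "m = m'" by (metis inj_map_eq_map)
  have eq: "?z C = ?z C'" using join ..
  have "map (\<lambda>k. digs (C k)) [0..<Suc n] = map (\<lambda>k. digs (C' k)) [0..<Suc n] \<and> ([] :: 'a sym list) = []"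
    using eq by (intro hash_join_append_inject[where P = "\<lambda>x. x \<noteq> SHash"]) (auto simp: digs_def)
  then show "C k = C' k" if "k \<le> n" for k
    using that by (auto simp del: upt_Suc)
qed

section \<open>Group elements and generators on partial fractions\<close>

context unit_differences
begin

lemma srel_ex:
  assumes i: "i < length l"
  shows "\<exists>a r C'. length a = length l \<and> (\<forall>k\<le>length l. srel l i b a r k (C k) (C' k))"
proof -
  have "\<forall>k. \<exists>x B. k < length l \<and> k \<noteq> i \<longrightarrow> chain (l ! i - l ! k) (False, x) (C k) B"
    using chain_ex units i by metis
  then obtain x B where B: "\<And>k. k < length l \<Longrightarrow> k \<noteq> i \<Longrightarrow> chain (l ! i - l ! k) (False, x k) (C k) (B k)"
    by metis
  obtain r Q where Q: "synth (l ! i) (False, r) (C (length l)) Q" using synth_ex by blast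
  define a where "a = map x [0..<length l]"
  define C' where "C' = (\<lambda>k. if k = length l then Q
     else if k = i then pCons (b + r - (\<Sum>j\<in>{..<length l} - {i}. a ! j)) (C i) else B k)"
  have "length a = length l" by (simp add: a_def)
  moreover have "srel l i b a r k (C k) (C' k)" if "k \<le> length l" for k
    using that B[of k] Q by (auto simp: srel_def C'_def a_def)
  ultimately show ?thesis by blast
qed

lemma linv_mult_val: "i < length l \<Longrightarrow> \<exists>C'. linv (l ! i) * val l C = val l C'"
  using srel_ex[of i 0 C] srel_val[of i l 0 _ _ C] by (metis add.right_neutral fls_const_0)

text \<open>Existence of partial fractions: start from a polynomial and divide by the factors one at
  a time. Each division is the generator computation with \<open>b = 0\<close>.\<close>

lemma Rd_imp_val:
  assumes "R \<in> Rd l"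
  shows "\<exists>C. R = val l C"
proof -
  from assms obtain P n where R: "R = poly_fls P * (\<Prod>k<length l. linv (l ! k) ^ n k)"
    unfolding Rd_def by blast
  have pow: "\<exists>C'. linv (l ! i) ^ N * val l C = val l C'" if "i < length l" for i N C
  proof (induction N)
    case (Suc N)
    then obtain C' where "linv (l ! i) ^ N * val l C = val l C'" by blast
    then have "linv (l ! i) ^ Suc N * val l C = linv (l ! i) * val l C'" by (simp add: mult.assoc)
    then show ?case using linv_mult_val[OF that, of C'] by simp
  qed auto
  have "\<exists>C. poly_fls P * (\<Prod>k\<in>S. linv (l ! k) ^ n k) = val l C" if "finite S" "S \<subseteq> {..<length l}" for S
    using that
  proof (induction S rule: finite_induct)
    case empty
    have "poly_fls P = val l (\<lambda>k. if k = length l then P else 0)"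
      by (simp add: val_def poly_fls_eq_ev)
    then show ?case by auto
  next
    case (insert x S)
    then obtain C where C: "poly_fls P * (\<Prod>k\<in>S. linv (l ! k) ^ n k) = val l C" by auto
    have "poly_fls P * (\<Prod>k\<in>insert x S. linv (l ! k) ^ n k) = linv (l ! x) ^ n x * val l C"
      unfolding C[symmetric] prod.insert[OF insert(1,2)] by (simp only: ac_simps)
    then show ?case using pow[of x "n x" C] insert by auto
  qed
  from this[of "{..<length l}"] show ?thesis unfolding R by simp
qed

lemma nf_eq_code:
  assumes "Ufac l (map uminus m) * R = val l C"
  shows "nf l (m, R) = code m (length l) C"
proof -
  have "prefix_str m = hash_join (map run m)"
    unfolding prefix_str_def run_def ..
  moreover have "suffix_str l (val l C) = hash_join (map (\<lambda>k. digs (C k)) [0..<Suc (length l)])"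
    by (simp add: suffix_str_def decomp_val digs_def o_def)
  ultimately show ?thesis by (simp add: nf_def code_def assms)
qed

lemma Gamma_val:
  assumes "(m, R) \<in> Gamma l"
  obtains C where "length m = length l" "Ufac l (map uminus m) * R = val l C"
  using assms Rd_imp_val Ufac_mult_Rd unfolding Gamma_def by blast

lemma val_Gamma:
  assumes "length m = length l"
  shows "(m, Ufac l m * val l C) \<in> Gamma l" "Ufac l (map uminus m) * (Ufac l m * val l C) = val l C"
proof -
  show "(m, Ufac l m * val l C) \<in> Gamma l"
    using assms by (simp add: Gamma_def Ufac_mult_Rd val_in_Rd)
  have "Ufac l (map uminus m) * (Ufac l m * val l C) = (Ufac l m * Ufac l (map uminus m)) * val l C"
    by (simp only: ac_simps)
  then show "Ufac l (map uminus m) * (Ufac l m * val l C) = val l C"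
    by (simp only: Ufac_uminus[OF assms] mult_1)
qed

text \<open>For composing relations through normal forms: a middle word must not stand for two group
  elements.\<close>

lemma nf_inject:
  assumes "g \<in> Gamma l" "h \<in> Gamma l" "nf l g = nf l h" "l \<noteq> []"
  shows "g = h"
proof -
  obtain m R m' R' where g: "g = (m, R)" and h: "h = (m', R')" by (metis surj_pair)
  obtain C where C: "length m = length l" "Ufac l (map uminus m) * R = val l C"
    using assms(1) unfolding g by (rule Gamma_val)
  obtain C' where C': "length m' = length l" "Ufac l (map uminus m') * R' = val l C'"
    using assms(2) unfolding h by (rule Gamma_val)
  have eq: "code m (length l) C = code m' (length l) C'"
    using assms(3) nf_eq_code[OF C(2)] nf_eq_code[OF C'(2)] by (simp add: g h)
  have "length m = length m'" "m \<noteq> []" using C C' assms(4) by auto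
  note inj = code_inject[OF eq this]
  have "val l C = val l C'" using inj(2) by (simp add: val_def)
  then have "Ufac l (map uminus m) * R = Ufac l (map uminus m) * R'" using C C' inj(1) by simp
  then have "Ufac l m * Ufac l (map uminus m) * R = Ufac l m * Ufac l (map uminus m) * R'"
    by (simp add: mult.assoc)
  then show ?thesis using Ufac_uminus[OF C(1)] inj(1) by (simp add: g h)
qed

lemma gmult_gen1:
  assumes "length m = length l" "i < length l"
  shows "gmult l (m, R) (gen1 l i b) = (m[i := m ! i + 1], R + Ufac l m * fls_const b)"
  using assms by (auto simp: gmult_def gen1_def intro!: nth_equalityI simp: nth_list_update)

text \<open>In matrices, a type 2 generator is the inverse of \<open>gen1 l j 0\<close> times
  \<open>gen1 l i b\<close>; written without inverses.\<close>

lemma gmult_gen1_gen2: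
  assumes "length m = length l" "i < length l" "j < length l" "i \<noteq> j"
  shows "gmult l (gmult l (m, R) (gen1 l j 0)) (gen2 l i j b) = gmult l (m, R) (gen1 l i b)"
proof -
  have "gmult l (m[j := m ! j + 1], R) (gen2 l i j b) =
      (m[i := m ! i + 1], R + Ufac l (m[j := m ! j + 1]) * (fls_const b * linv (l ! j)))"
    using assms by (auto simp: gmult_def gen2_def nth_list_update intro!: nth_equalityI)
  also have "Ufac l (m[j := m ! j + 1]) * (fls_const b * linv (l ! j)) = Ufac l m * fls_const b"
    unfolding Ufac_update[OF assms(1,3)] by (simp add: ac_simps)
  finally show ?thesis using assms by (simp add: gmult_gen1)
qed

definition gen1_rel :: "nat \<Rightarrow> 'a \<Rightarrow> ('a sym list \<times> 'a sym list) set" where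
  "gen1_rel i b = {(nf l g, nf l (gmult l g (gen1 l i b))) | g. g \<in> Gamma l}"

text \<open>Dividing \<open>R + U b\<close> by \<open>(t + l_i) U\<close> gives
  \<open>(R' + b) / (t + l_i)\<close>, the quantity of \<open>srel_val\<close>. That lemma yields
  soundness: residues passing every block test describe the true product. Completeness is
  \<open>srel_ex\<close>.\<close>

lemma gen1_rel_eq_code:
  assumes i: "i < length l"
  shows "gen1_rel i b = {(code m (length l) C, code (m[i := m ! i + 1]) (length l) C') | m C C'.
    length m = length l \<and> (\<exists>a r. length a = length l \<and> (\<forall>k\<le>length l. srel l i b a r k (C k) (C' k)))}"
    (is "_ = ?r")
proof -
  have val': "Ufac l (map uminus (m[i := m ! i + 1])) * (R + Ufac l m * fls_const b) = val l C'"
    if "length m = length l" "Ufac l (map uminus m) * R = val l C"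
      "\<forall>k\<le>length l. srel l i b a r k (C k) (C' k)" for m R C C' a r
  proof -
    have "Ufac l (map uminus (m[i := m ! i + 1])) * (R + Ufac l m * fls_const b) =
        linv (l ! i) * (Ufac l (map uminus m) * R + (Ufac l m * Ufac l (map uminus m)) * fls_const b)"
      unfolding Ufac_uminus_update[OF that(1) i] by (simp add: algebra_simps)
    also have "\<dots> = val l C'"
      unfolding Ufac_uminus[OF that(1)] that(2) using srel_val[OF i, of b a r C C'] that(3) by simp
    finally show ?thesis .
  qed
  show ?thesis
  proof (intro equalityI subsetI)
    fix p assume "p \<in> gen1_rel i b"
    then obtain m R where g: "(m, R) \<in> Gamma l" and p: "p = (nf l (m, R), nf l (gmult l (m, R) (gen1 l i b)))"
      unfolding gen1_rel_def by auto
    obtain C where C: "length m = length l" "Ufac l (map uminus m) * R = val l C"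
      using g by (rule Gamma_val)
    obtain a r C' where C': "length a = length l" "\<forall>k\<le>length l. srel l i b a r k (C k) (C' k)"
      using srel_ex[OF i] by blast
    have "p = (code m (length l) C, code (m[i := m ! i + 1]) (length l) C')"
      unfolding p gmult_gen1[OF C(1) i] nf_eq_code[OF C(2)] nf_eq_code[OF val'[OF C C'(2)]] ..
    then show "p \<in> ?r" using C(1) C' by blast
  next
    fix p assume "p \<in> ?r"
    then obtain m C C' a r where p: "p = (code m (length l) C, code (m[i := m ! i + 1]) (length l) C')"
      and m: "length m = length l" and C': "\<forall>k\<le>length l. srel l i b a r k (C k) (C' k)"
      by auto
    let ?g = "(m, Ufac l m * val l C)"
    have "p = (nf l ?g, nf l (gmult l ?g (gen1 l i b)))"
      unfolding p gmult_gen1[OF m i] nf_eq_code[OF val_Gamma(2)[OF m]]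
        nf_eq_code[OF val'[OF m val_Gamma(2)[OF m] C']] ..
    then show "p \<in> gen1_rel i b" unfolding gen1_rel_def using val_Gamma(1)[OF m] by blast
  qed
qed

lemma gen2_rel_eq:
  assumes "i < length l" "j < length l" "i \<noteq> j"
  shows "{(nf l g, nf l (gmult l g (gen2 l i j b))) | g. g \<in> Gamma l} = (gen1_rel j 0)\<inverse> O gen1_rel i b"
    (is "?l = ?r")
proof (intro equalityI subsetI)
  fix p assume "p \<in> ?l"
  then obtain m R where g: "(m, R) \<in> Gamma l" and p: "p = (nf l (m, R), nf l (gmult l (m, R) (gen2 l i j b)))"
    by auto
  \<comment> \<open>The middle element is \<open>g\<close> times the inverse of
    \<open>gen1 l j 0\<close>. That generator is diagonal, so only the exponent at \<open>j\<close>
    changes and \<open>R\<close> stays.\<close>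
  let ?m = "m[j := m ! j - 1]"
  have m: "length m = length l" using g by (simp add: Gamma_def)
  have k: "(?m, R) \<in> Gamma l" using g by (simp add: Gamma_def)
  have e: "gmult l (?m, R) (gen1 l j 0) = (m, R)"
    using m assms(2) by (simp add: gmult_gen1)
  have "p = (nf l (gmult l (?m, R) (gen1 l j 0)), nf l (gmult l (?m, R) (gen1 l i b)))"
    using gmult_gen1_gen2[of ?m i j R b] m assms unfolding p e by simp
  moreover have "(nf l (gmult l (?m, R) (gen1 l j 0)), nf l (?m, R)) \<in> (gen1_rel j 0)\<inverse>"
    "(nf l (?m, R), nf l (gmult l (?m, R) (gen1 l i b))) \<in> gen1_rel i b"
    unfolding gen1_rel_def using k by blast+
  ultimately show "p \<in> ?r" by blast
next
  fix p assume "p \<in> ?r"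
  then obtain u v w where p: "p = (u, w)" "(v, u) \<in> gen1_rel j 0" "(v, w) \<in> gen1_rel i b" by blast
  from p(2) obtain m R where 1: "(m, R) \<in> Gamma l" "v = nf l (m, R)" "u = nf l (gmult l (m, R) (gen1 l j 0))"
    unfolding gen1_rel_def by auto
  from p(3) obtain h where 2: "h \<in> Gamma l" "v = nf l h" "w = nf l (gmult l h (gen1 l i b))"
    unfolding gen1_rel_def by auto
  have "l \<noteq> []" using assms by auto
  \<comment> \<open>Both factors of the composition now start from the same group element.\<close>
  then have h: "h = (m, R)" using nf_inject 1 2 by metis
  have m: "length m = length l" using 1 by (simp add: Gamma_def)
  have "gmult l (m, R) (gen1 l j 0) \<in> Gamma l"
    using 1(1) m assms(2) by (simp add: gmult_gen1 Gamma_def)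
  moreover have "w = nf l (gmult l (gmult l (m, R) (gen1 l j 0)) (gen2 l i j b))"
    unfolding 2(3) h gmult_gen1_gen2[OF m assms] ..
  ultimately show "p \<in> ?l" unfolding p(1) 1(3) by blast
qed

end

section \<open>Assembling the blocks\<close>

lemma joinrel_map_iff:
  "(u, v) \<in> joinrel (map (\<lambda>k. {(f x, f y) | x y. P k x y}) [0..<n]) \<longleftrightarrow>
    (\<exists>X Y. u = hash_join (map (\<lambda>k. f (X k)) [0..<n]) \<and> v = hash_join (map (\<lambda>k. f (Y k)) [0..<n]) \<and>
      (\<forall>k<n. P k (X k) (Y k)))"
    (is "?l \<longleftrightarrow> ?r")
proof
  assume ?l
  then obtain us vs where us: "u = hash_join us" "v = hash_join vs" "length us = n" "length vs = n"
    "\<forall>k<n. \<exists>x y. us ! k = f x \<and> vs ! k = f y \<and> P k x y"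
    unfolding joinrel_iff by auto
  then obtain X Y where XY: "\<And>k. k < n \<Longrightarrow> us ! k = f (X k) \<and> vs ! k = f (Y k) \<and> P k (X k) (Y k)"
    by metis
  have "us = map (\<lambda>k. f (X k)) [0..<n]" "vs = map (\<lambda>k. f (Y k)) [0..<n]"
    using us XY by (auto intro!: nth_equalityI)
  then show ?r using us XY by blast
next
  assume ?r
  then obtain X Y where "u = hash_join (map (\<lambda>k. f (X k)) [0..<n])" "v = hash_join (map (\<lambda>k. f (Y k)) [0..<n])"
    "\<forall>k<n. P k (X k) (Y k)" by blast
  then show ?l
    unfolding joinrel_iff
    by (intro exI[of _ "map (\<lambda>k. f (X k)) [0..<n]"] exI[of _ "map (\<lambda>k. f (Y k)) [0..<n]"]) auto
qed

locale finite_unit_differences = unit_differences l for l :: "'a::{finite,comm_ring_1} list"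
begin

definition prefix_rel :: "nat \<Rightarrow> ('a sym list \<times> 'a sym list) set" where
  "prefix_rel i = joinrel (map (\<lambda>k. {(run x, run y) | x y. y = x + (if k = i then 1 else 0)}) [0..<length l])"

definition suffix_rel :: "nat \<Rightarrow> 'a \<Rightarrow> 'a list \<Rightarrow> 'a \<Rightarrow> ('a sym list \<times> 'a sym list) set" where
  "suffix_rel i b a r = joinrel (map (\<lambda>k. polyrel (srel l i b a r k)) [0..<Suc (length l)])"

lemma autom_prefix_suffix:
  assumes i: "i < length l"
  shows "autom (prefix_rel i \<odot> suffix_rel i b a r)"
proof -
  have "autom (joinrel (map (\<lambda>k. polyrel (srel l i b a r k)) [0..<length l] @ [polyrel (srel l i b a r (length l))])
      \<odot> {([], [])})"
  proof (rule autom_joinrel)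
    show "\<forall>B\<in>set (map (\<lambda>k. polyrel (srel l i b a r k)) [0..<length l]). block B"
      using i by (auto simp: srel_def intro!: block_insert_digit block_chain units)
    show "autom (polyrel (srel l i b a r (length l)) \<odot> {([], [])})"
      by (simp add: srel_def autom_synth)
  qed
  then have suf: "autom (suffix_rel i b a r)" by (simp add: suffix_rel_def)
  define pr :: "nat \<Rightarrow> ('a sym list \<times> 'a sym list) set"
    where "pr = (\<lambda>k. {(run x, run y) | x y. y = x + (if k = i then 1 else 0)})"
  have pr: "block (pr k)" for k
    using block_run block_run_Suc unfolding pr_def by (cases "k = i") auto
  \<comment> \<open>No hash stands between prefix and suffix, so the last exponent block is split
    off and continued by the whole suffix.\<close>
  obtain n where n: "length l = Suc n" using i by (cases "length l") auto
  have "autom (joinrel (map pr [0..<n] @ [pr n]) \<odot> suffix_rel i b a r)"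
    by (rule autom_joinrel) (auto intro: pr block_autom[OF pr suf])
  then show ?thesis by (simp add: prefix_rel_def n pr_def)
qed

text \<open>For fixed residues each block is constrained by itself, so a finite union over
  \<open>a\<close> and \<open>r\<close> replaces all dependence between blocks.\<close>

lemma gen1_rel_eq_UN:
  assumes i: "i < length l"
  shows "gen1_rel i b = (\<Union>(a, r)\<in>{a. length a = length l} \<times> UNIV. prefix_rel i \<odot> suffix_rel i b a r)"
    (is "_ = ?r")
proof (intro equalityI subsetI)
  fix p assume "p \<in> gen1_rel i b"
  then obtain m C C' a r where p: "p = (code m (length l) C, code (m[i := m ! i + 1]) (length l) C')"
    and m: "length m = length l" and a: "length a = length l"
    and C: "\<forall>k\<le>length l. srel l i b a r k (C k) (C' k)"
    unfolding gen1_rel_eq_code[OF i] by blast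
  have "(hash_join (map run m), hash_join (map run (m[i := m ! i + 1]))) \<in> prefix_rel i"
    unfolding prefix_rel_def joinrel_map_iff
  proof (intro exI conjI)
    show "hash_join (map run m) = hash_join (map (\<lambda>k. run (m ! k)) [0..<length l])"
      using m by (auto intro!: arg_cong[of _ _ hash_join] nth_equalityI)
    show "hash_join (map run (m[i := m ! i + 1])) =
        hash_join (map (\<lambda>k. run (m ! k + (if k = i then 1 else 0))) [0..<length l])"
      using m i by (auto simp: nth_list_update intro!: arg_cong[of _ _ hash_join] nth_equalityI)
  qed simp
  moreover have "(hash_join (map (\<lambda>k. digs (C k)) [0..<Suc (length l)]),
      hash_join (map (\<lambda>k. digs (C' k)) [0..<Suc (length l)])) \<in> suffix_rel i b a r"
    unfolding suffix_rel_def polyrel_def joinrel_map_iff using C by (intro exI conjI) auto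
  ultimately have "p \<in> prefix_rel i \<odot> suffix_rel i b a r"
    unfolding p code_def by (rule concI)
  then show "p \<in> ?r" using a by auto
next
  fix p assume "p \<in> ?r"
  then obtain a r where a: "length a = length l" and "p \<in> prefix_rel i \<odot> suffix_rel i b a r" by auto
  then obtain u v u' v' where p: "p = (u @ u', v @ v')" "(u, v) \<in> prefix_rel i" "(u', v') \<in> suffix_rel i b a r"
    by (elim concE) blast
  obtain X Y where XY: "u = hash_join (map (\<lambda>k. run (X k)) [0..<length l])"
    "v = hash_join (map (\<lambda>k. run (Y k)) [0..<length l])" "\<forall>k<length l. Y k = X k + (if k = i then 1 else 0)"
    using p(2) unfolding prefix_rel_def joinrel_map_iff by blast
  obtain C C' where C: "u' = hash_join (map (\<lambda>k. digs (C k)) [0..<Suc (length l)])"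
    "v' = hash_join (map (\<lambda>k. digs (C' k)) [0..<Suc (length l)])"
    "\<forall>k<Suc (length l). srel l i b a r k (C k) (C' k)"
    using p(3) unfolding suffix_rel_def polyrel_def joinrel_map_iff by blast
  define m where "m = map X [0..<length l]"
  have m: "length m = length l" by (simp add: m_def)
  have "(map run m :: 'a sym list list) = map (\<lambda>k. run (X k)) [0..<length l]"
    by (simp add: m_def)
  moreover have "(map run (m[i := m ! i + 1]) :: 'a sym list list) = map (\<lambda>k. run (Y k)) [0..<length l]"
    using i XY(3) by (auto simp: m_def nth_list_update intro!: nth_equalityI)
  ultimately have "p = (code m (length l) C, code (m[i := m ! i + 1]) (length l) C')"
    unfolding p XY(1,2) C(1,2) code_def by (simp only:)
  moreover have "\<forall>k\<le>length l. srel l i b a r k (C k) (C' k)" using C(3) by simp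
  ultimately show "p \<in> gen1_rel i b"
    unfolding gen1_rel_eq_code[OF i] using m a by blast
qed

lemma autom_gen1_rel:
  assumes "i < length l"
  shows "autom (gen1_rel i b)"
  unfolding gen1_rel_eq_UN[OF assms]
proof (rule autom_UN)
  have "finite {a :: 'a list. length a = length l}"
    using finite_lists_length_eq[of "UNIV :: 'a set" "length l"] by simp
  then show "finite ({a :: 'a list. length a = length l} \<times> (UNIV :: 'a set))" by simp
qed (auto intro: autom_prefix_suffix[OF assms])

end

theorem theorem5p1:
  fixes d :: nat and l :: "'q::nontriv mod_ring list" and s :: "int list \<times> 'q mod_ring fls"
  assumes "d \<ge> 3"
    and "length l = d - 1"
    and "distinct l"
    and "\<forall>k<d - 1. invertible_el (l ! k)"
    and "\<forall>i<d - 1. \<forall>j<d - 1. i \<noteq> j \<longrightarrow> invertible_el (l ! i - l ! j)"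
    and "(\<exists>i b. i < d - 1 \<and> s = gen1 l i b) \<or> (\<exists>i j b. i < j \<and> j < d - 1 \<and> s = gen2 l i j b)"
  shows "regular_lang UNIV (Ls l s)"
proof -
  interpret finite_unit_differences l
    using assms(2,5) by unfold_locales simp
  have "autom {(nf l g, nf l (gmult l g s)) | g. g \<in> Gamma l}"
    using assms(6)
  proof (elim disjE exE conjE)
    fix i b assume "i < d - 1" "s = gen1 l i b"
    then show ?thesis using autom_gen1_rel[of i b] assms(2) by (simp add: gen1_rel_def)
  next
    fix i j b assume ij: "i < j" "j < d - 1" "s = gen2 l i j b"
    then have "i < length l" "j < length l" "i \<noteq> j" using assms(2) by auto
    then show ?thesis
      unfolding ij(3) gen2_rel_eq[OF \<open>i < length l\<close> \<open>j < length l\<close> \<open>i \<noteq> j\<close>]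
      by (intro autom_relcomp autom_converse autom_gen1_rel)
  qed
  moreover have "Ls l s = {conv u v | u v. (u, v) \<in> {(nf l g, nf l (gmult l g s)) | g. g \<in> Gamma l}}"
    unfolding Ls_def by blast
  ultimately show ?thesis using autom_regular_lang by (simp only:)
qed

end
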